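(* Let $M^4\subset\mathbb{R}^{4+r}$ be an austere 4-fold of type A, and for each $p\in M$ let $|\mathrm{II}_p|$ be $O(4)$-conjugate to a subspace $\mathcal{Q}(p)\subset\mathcal{Q}_A$. Define the linear map $$\mathsf{K}: S\mapsto \big([S,T]\ \big|\ [S,U]\big)$$ from the space of real $4\times4$ matrices $S$ to the space of real $4\times 8$ matrices, where $[\cdot,\cdot]$ is the matrix commutator. Suppose that for every $p\in M$ the image $\mathsf{K}(\mathcal{Q}(p))$ has the property that the common nullspace (in $\mathbb{R}^8$) of all the matrices in this image is zero. Then $M$, with the metric induced from $\mathbb{R}^{4+r}$, is Kähler with respect to the complex structure on $M$ defined by $J$.
   Context: For an immersed submanifold $M\subset\mathbb{R}^{n+r}$ of dimension $n$, the second fundamental form is $\mathrm{II}(X,Y)=\pi_N\nabla_XY$ (normal projection of the Euclidean derivative), and $|\mathrm{II}_p|\subset S^2T_p^*M$ is the space of all quadratic forms $\nu\cdot\mathrm{II}_p$, with $\nu$ normal to $M$ at $p$. $M$ is austere if, for every normal vector $\nu$, the eigenvalues of $\nu\cdot\mathrm{II}$ with respect to the induced metric are symmetrically arranged around zero. $\mathcal{Q}_A=\left\{\begin{bmatrix}A&B\\ B&-A\end{bmatrix}: A,B \text{ real symmetric } 2\times2\right\}$. An austere $M^4$ is of type A if for every $p$ the space $|\mathrm{II}_p|$ is $O(4)$-conjugate to a subspace of $\mathcal{Q}_A$, i.e. there is an orthonormal basis $e_1,\dots,e_4$ of $T_pM$ in which all forms in $|\mathrm{II}_p|$ are represented by matrices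 in $\mathcal{Q}_A$; locally such bases are taken to form a smooth orthonormal frame, and $\mathcal{Q}(p)$ is the space of matrices representing $|\mathrm{II}_p|$ in it. No relation between $r$ and $\dim|\mathrm{II}_p|$ is assumed. The matrices are $$J=\begin{bmatrix}0&0&-1&0\\0&0&0&-1\\1&0&0&0\\0&1&0&0\end{bmatrix},\quad T=\begin{bmatrix}0&-1&0&0\\1&0&0&0\\0&0&0&1\\0&0&-1&0\end{bmatrix},\quad U=-JT=\begin{bmatrix}0&0&0&1\\0&0&-1&0\\0&1&0&0\\-1&0&0&0\end{bmatrix}.$$ The (almost) complex structure on $M$ defined by $J$ is the one represented by $J$ in the adapted orthonormal frame, i.e. $e_1\mapsto e_3$, $e_2\mapsto e_4$, $e_3\mapsto -e_1$, $e_4\mapsto -e_2$. *)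

theory Defs
  imports "HOL-Analysis.Analysis"
begin

subsection \<open>Smooth maps and manifolds\<close>

primrec C_k_on :: "nat \<Rightarrow> 'a::real_normed_vector set \<Rightarrow> ('a \<Rightarrow> 'b::real_normed_vector) \<Rightarrow> bool"
where
  "C_k_on 0 S f \<longleftrightarrow> continuous_on S f"
| "C_k_on (Suc k) S f \<longleftrightarrow> (\<forall>x\<in>S. f differentiable (at x)) \<and>
     (\<forall>v. C_k_on k S (\<lambda>x. frechet_derivative f (at x) v))"

text \<open>Only used for open \<^term>\<open>S\<close>; the domains below are finite-dimensional.\<close>

definition smooth_on :: "'a::real_normed_vector set \<Rightarrow> ('a \<Rightarrow> 'b::real_normed_vector) \<Rightarrow> bool" where
  "smooth_on S f \<longleftrightarrow> (\<forall>k. C_k_on k S f)"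

type_synonym ('m, 'e) chart = "'m set \<times> ('m \<Rightarrow> 'e)"

definition param :: "('m, 'e) chart \<Rightarrow> 'e \<Rightarrow> 'm" where
  "param c = inv_into (fst c) (snd c)"

text \<open>The manifold is the whole type \<^typ>\<open>'m\<close>; its dimension is that of \<^typ>\<open>'e\<close>.\<close>

definition smooth_atlas ::
  "('m::topological_space, 'e::euclidean_space) chart set \<Rightarrow> bool" where
  "smooth_atlas \<A> \<longleftrightarrow>
     (\<Union>c\<in>\<A>. fst c) = UNIV \<and>
     (\<forall>(U, \<phi>)\<in>\<A>. open U \<and> open (\<phi> ` U) \<and> homeomorphism U (\<phi> ` U) \<phi> (param (U, \<phi>))) \<and>
     (\<forall>(U, \<phi>)\<in>\<A>. \<forall>(V, \<psi>)\<in>\<A>. smooth_on (\<phi> ` (U \<inter> V)) (\<psi> \<circ> param (U, \<phi>)))"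

definition smooth_map_on ::
  "('m::topological_space, 'e::euclidean_space) chart set \<Rightarrow> 'm set
     \<Rightarrow> ('m \<Rightarrow> 'b::real_normed_vector) \<Rightarrow> bool" where
  "smooth_map_on \<A> W f \<longleftrightarrow> (\<forall>(U, \<phi>)\<in>\<A>. smooth_on (\<phi> ` (U \<inter> W)) (f \<circ> param (U, \<phi>)))"

definition chart_derivative ::
  "('m, 'e::euclidean_space) chart \<Rightarrow> ('m \<Rightarrow> 'b::real_normed_vector) \<Rightarrow> 'm \<Rightarrow> 'e \<Rightarrow> 'b" where
  "chart_derivative c f p = frechet_derivative (f \<circ> param c) (at (snd c p))"


subsection \<open>Immersed submanifolds of Euclidean space\<close>

definition immersion ::
  "('m::topological_space, 'e::euclidean_space) chart set \<Rightarrow> ('m \<Rightarrow> 'v::euclidean_space) \<Rightarrow> bool" where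
  "immersion \<A> F \<longleftrightarrow> smooth_map_on \<A> UNIV F \<and>
     (\<forall>c\<in>\<A>. \<forall>p\<in>fst c. inj (chart_derivative c F p))"

text \<open>
  The tangent space at \<^term>\<open>p\<close> is identified with its image under the differential of the
  immersion \<^term>\<open>F\<close>, so that the induced metric is the inner product of the ambient space.
\<close>

definition tangent_space ::
  "('m, 'e::euclidean_space) chart set \<Rightarrow> ('m \<Rightarrow> 'v::euclidean_space) \<Rightarrow> 'm \<Rightarrow> 'v set" where
  "tangent_space \<A> F p = (\<Union>c\<in>{c\<in>\<A>. p \<in> fst c}. range (chart_derivative c F p))"

definition normal_space ::
  "('m, 'e::euclidean_space) chart set \<Rightarrow> ('m \<Rightarrow> 'v::euclidean_space) \<Rightarrow> 'm \<Rightarrow> 'v set" where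
  "normal_space \<A> F p = (tangent_space \<A> F p)\<^sup>\<bottom>"

definition normal_proj ::
  "('m, 'e::euclidean_space) chart set \<Rightarrow> ('m \<Rightarrow> 'v::euclidean_space) \<Rightarrow> 'm \<Rightarrow> 'v \<Rightarrow> 'v" where
  "normal_proj \<A> F p w = (THE n. n \<in> normal_space \<A> F p \<and> w - n \<in> tangent_space \<A> F p)"

text \<open>
  \<^term>\<open>dir_deriv \<A> F f p v\<close> is the derivative of the vector-valued function \<^term>\<open>f\<close> at
  \<^term>\<open>p\<close> in the direction of the tangent vector \<^term>\<open>v\<close>. By the chain rule it does not depend
  on the chart, hence the definite description.
\<close>

definition dir_deriv ::
  "('m, 'e::euclidean_space) chart set \<Rightarrow> ('m \<Rightarrow> 'v::euclidean_space)
     \<Rightarrow> ('m \<Rightarrow> 'b::real_normed_vector) \<Rightarrow> 'm \<Rightarrow> 'v \<Rightarrow> 'b" where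
  "dir_deriv \<A> F f p v =
     (THE w. \<exists>c\<in>\<A>. p \<in> fst c \<and> (\<exists>a. v = chart_derivative c F p a \<and> w = chart_derivative c f p a))"

definition vector_field_on ::
  "('m::topological_space, 'e::euclidean_space) chart set \<Rightarrow> ('m \<Rightarrow> 'v::euclidean_space)
     \<Rightarrow> 'm set \<Rightarrow> ('m \<Rightarrow> 'v) \<Rightarrow> bool" where
  "vector_field_on \<A> F W X \<longleftrightarrow> smooth_map_on \<A> W X \<and> (\<forall>p\<in>W. X p \<in> tangent_space \<A> F p)"

text \<open>
  The normal part of the derivative of \<^term>\<open>Y\<close> along \<^term>\<open>u\<close> is tensorial in \<^term>\<open>Y\<close>, so any
  local tangent field \<^term>\<open>Y\<close> extending \<^term>\<open>v\<close> gives the same value.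
\<close>

definition second_ff ::
  "('m::topological_space, 'e::euclidean_space) chart set \<Rightarrow> ('m \<Rightarrow> 'v::euclidean_space)
     \<Rightarrow> 'm \<Rightarrow> 'v \<Rightarrow> 'v \<Rightarrow> 'v" where
  "second_ff \<A> F p u v =
     (let Y = (SOME Y. \<exists>W. open W \<and> p \<in> W \<and> vector_field_on \<A> F W Y \<and> Y p = v)
      in normal_proj \<A> F p (dir_deriv \<A> F Y p u))"

text \<open>
  The space of quadratic forms, given by their polar bilinear forms; they are meaningful on the
  tangent space only.
\<close>

definition second_ff_forms ::
  "('m::topological_space, 'e::euclidean_space) chart set \<Rightarrow> ('m \<Rightarrow> 'v::euclidean_space)
     \<Rightarrow> 'm \<Rightarrow> ('v \<Rightarrow> 'v \<Rightarrow> real) set" where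
  "second_ff_forms \<A> F p = {\<lambda>u v. \<nu> \<bullet> second_ff \<A> F p u v | \<nu>. \<nu> \<in> normal_space \<A> F p}"

definition eigenspace :: "'v::euclidean_space set \<Rightarrow> ('v \<Rightarrow> 'v \<Rightarrow> real) \<Rightarrow> real \<Rightarrow> 'v set" where
  "eigenspace T h \<mu> = {u\<in>T. \<forall>v\<in>T. h u v = \<mu> * (u \<bullet> v)}"

text \<open>
  The forms are symmetric, so the multiplicity of an eigenvalue is the dimension of its
  eigenspace (zero if it is not an eigenvalue).
\<close>

definition austere ::
  "('m::topological_space, 'e::euclidean_space) chart set \<Rightarrow> ('m \<Rightarrow> 'v::euclidean_space) \<Rightarrow> bool" where
  "austere \<A> F \<longleftrightarrow> (\<forall>p. \<forall>h\<in>second_ff_forms \<A> F p. \<forall>\<mu>.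
     dim (eigenspace (tangent_space \<A> F p) h \<mu>) = dim (eigenspace (tangent_space \<A> F p) h (- \<mu>)))"

definition orthonormal_basis :: "'v::euclidean_space set \<Rightarrow> ('i \<Rightarrow> 'v) \<Rightarrow> bool" where
  "orthonormal_basis T b \<longleftrightarrow> (\<forall>i j. b i \<bullet> b j = (if i = j then 1 else 0)) \<and> span (range b) = T"

definition form_matrix :: "('i::finite \<Rightarrow> 'v) \<Rightarrow> ('v \<Rightarrow> 'v \<Rightarrow> real) \<Rightarrow> real^'i^'i" where
  "form_matrix b h = (\<chi> i j. h (b i) (b j))"


subsection \<open>Austere fourfolds of type A\<close>

definition Q_A :: "(real^4^4) set" where
  "Q_A = {vector [vector [A$1$1, A$1$2, B$1$1, B$1$2],
                  vector [A$2$1, A$2$2, B$2$1, B$2$2],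
                  vector [B$1$1, B$1$2, - A$1$1, - A$1$2],
                  vector [B$2$1, B$2$2, - A$2$1, - A$2$2]]
          | (A::real^2^2) (B::real^2^2). transpose A = A \<and> transpose B = B}"

definition J_mat :: "real^4^4" where
  "J_mat = vector [vector [0, 0, - 1, 0],
                   vector [0, 0, 0, - 1],
                   vector [1, 0, 0, 0],
                   vector [0, 1, 0, 0]]"

definition T_mat :: "real^4^4" where
  "T_mat = vector [vector [0, - 1, 0, 0],
                   vector [1, 0, 0, 0],
                   vector [0, 0, 0, 1],
                   vector [0, 0, - 1, 0]]"

definition U_mat :: "real^4^4" where
  "U_mat = vector [vector [0, 0, 0, 1],
                   vector [0, 0, - 1, 0],
                   vector [0, 1, 0, 0],
                   vector [- 1, 0, 0, 0]]"

lemma vector_4 [simp]: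
  "(vector [w, x, y, z] :: 'a::zero^4) $ 1 = w"
  "(vector [w, x, y, z] :: 'a::zero^4) $ 2 = x"
  "(vector [w, x, y, z] :: 'a::zero^4) $ 3 = y"
  "(vector [w, x, y, z] :: 'a::zero^4) $ 4 = z"
  by (simp_all add: vector_def)

lemma U_mat_eq: "U_mat = - (J_mat ** T_mat)"
  by (simp add: vec_eq_iff matrix_matrix_mult_def forall_4 sum_4 J_mat_def T_mat_def U_mat_def)

definition commutator :: "real^4^4 \<Rightarrow> real^4^4 \<Rightarrow> real^4^4" where
  "commutator X Y = X ** Y - Y ** X"

text \<open>The columns of a 4 by 8 block matrix are indexed by \<^typ>\<open>4 + 4\<close>.\<close>

definition K_map :: "real^4^4 \<Rightarrow> real^(4 + 4)^4" where
  "K_map S = (\<chi> i j. case j of Inl k \<Rightarrow> commutator S T_mat $ i $ k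
                              | Inr k \<Rightarrow> commutator S U_mat $ i $ k)"

definition common_nullspace :: "(real^'n^'m) set \<Rightarrow> (real^'n) set" where
  "common_nullspace \<M> = {x. \<forall>A\<in>\<M>. A *v x = 0}"

definition type_A ::
  "('m::topological_space, real^4) chart set \<Rightarrow> ('m \<Rightarrow> 'v::euclidean_space) \<Rightarrow> bool" where
  "type_A \<A> F \<longleftrightarrow> (\<forall>p. \<exists>b :: 4 \<Rightarrow> 'v. orthonormal_basis (tangent_space \<A> F p) b \<and>
     form_matrix b ` second_ff_forms \<A> F p \<subseteq> Q_A)"

definition Q_space ::
  "('m::topological_space, real^4) chart set \<Rightarrow> ('m \<Rightarrow> 'v::euclidean_space)
     \<Rightarrow> (4 \<Rightarrow> 'm \<Rightarrow> 'v) \<Rightarrow> 'm \<Rightarrow> (real^4^4) set" where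
  "Q_space \<A> F e p = form_matrix (\<lambda>i. e i p) ` second_ff_forms \<A> F p"

definition adapted_frame ::
  "('m::topological_space, real^4) chart set \<Rightarrow> ('m \<Rightarrow> 'v::euclidean_space)
     \<Rightarrow> 'm set \<Rightarrow> (4 \<Rightarrow> 'm \<Rightarrow> 'v) \<Rightarrow> bool" where
  "adapted_frame \<A> F W e \<longleftrightarrow> open W \<and> (\<forall>i. vector_field_on \<A> F W (e i)) \<and>
     (\<forall>p\<in>W. orthonormal_basis (tangent_space \<A> F p) (\<lambda>i. e i p) \<and> Q_space \<A> F e p \<subseteq> Q_A)"

text \<open>Linear maps are represented by the matrix of their action on coordinate columns.\<close>

definition represented_by ::
  "('m \<Rightarrow> 'v \<Rightarrow> 'v) \<Rightarrow> 'm set \<Rightarrow> ('i::finite \<Rightarrow> 'm \<Rightarrow> 'v::euclidean_space) \<Rightarrow> real^'i^'i \<Rightarrow> bool" where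
  "represented_by \<J> W e A \<longleftrightarrow> (\<forall>p\<in>W. \<forall>x :: real^'i.
     \<J> p (\<Sum>i\<in>UNIV. (x $ i) *\<^sub>R e i p) = (\<Sum>i\<in>UNIV. ((A *v x) $ i) *\<^sub>R e i p))"


subsection \<open>Kaehler structures with respect to the induced metric\<close>

definition almost_complex ::
  "('m::topological_space, 'e::euclidean_space) chart set \<Rightarrow> ('m \<Rightarrow> 'v::euclidean_space)
     \<Rightarrow> ('m \<Rightarrow> 'v \<Rightarrow> 'v) \<Rightarrow> bool" where
  "almost_complex \<A> F \<J> \<longleftrightarrow>
     (\<forall>p. \<forall>u\<in>tangent_space \<A> F p. \<J> p u \<in> tangent_space \<A> F p \<and> \<J> p (\<J> p u) = - u \<and>
        (\<forall>v\<in>tangent_space \<A> F p. \<forall>a b. \<J> p (a *\<^sub>R u + b *\<^sub>R v) = a *\<^sub>R \<J> p u + b *\<^sub>R \<J> p v)) \<and>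
     (\<forall>W X. open W \<and> vector_field_on \<A> F W X \<longrightarrow> vector_field_on \<A> F W (\<lambda>p. \<J> p (X p)))"

text \<open>
  Integrability means that \<^term>\<open>\<J>\<close> comes from a complex manifold structure: near every
  point there are complex coordinates \<^term>\<open>z\<close> whose differential intertwines \<^term>\<open>\<J>\<close> with
  multiplication by the imaginary unit. An injective smooth map with injective differential
  between manifolds of equal dimension is a diffeomorphism onto an open set, so no condition on
  the inverse is needed.
\<close>

definition complex_coordinates_on ::
  "('m::topological_space, real^4) chart set \<Rightarrow> ('m \<Rightarrow> 'v::euclidean_space)
     \<Rightarrow> ('m \<Rightarrow> 'v \<Rightarrow> 'v) \<Rightarrow> 'm set \<Rightarrow> ('m \<Rightarrow> complex^2) \<Rightarrow> bool" where
  "complex_coordinates_on \<A> F \<J> W z \<longleftrightarrow>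
     open W \<and> smooth_map_on \<A> W z \<and> inj_on z W \<and>
     (\<forall>p\<in>W. inj_on (dir_deriv \<A> F z p) (tangent_space \<A> F p) \<and>
       (\<forall>v\<in>tangent_space \<A> F p. dir_deriv \<A> F z p (\<J> p v) = \<i> *s dir_deriv \<A> F z p v))"

definition complex_structure ::
  "('m::topological_space, real^4) chart set \<Rightarrow> ('m \<Rightarrow> 'v::euclidean_space)
     \<Rightarrow> ('m \<Rightarrow> 'v \<Rightarrow> 'v) \<Rightarrow> bool" where
  "complex_structure \<A> F \<J> \<longleftrightarrow> almost_complex \<A> F \<J> \<and>
     (\<forall>p. \<exists>W z. p \<in> W \<and> complex_coordinates_on \<A> F \<J> W z)"

definition hermitian ::
  "('m, 'e::euclidean_space) chart set \<Rightarrow> ('m \<Rightarrow> 'v::euclidean_space)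
     \<Rightarrow> ('m \<Rightarrow> 'v \<Rightarrow> 'v) \<Rightarrow> bool" where
  "hermitian \<A> F \<J> \<longleftrightarrow>
     (\<forall>p. \<forall>u\<in>tangent_space \<A> F p. \<forall>v\<in>tangent_space \<A> F p. \<J> p u \<bullet> \<J> p v = u \<bullet> v)"

definition form_in_chart ::
  "('m, 'e::euclidean_space) chart \<Rightarrow> ('m \<Rightarrow> 'v::euclidean_space)
     \<Rightarrow> ('m \<Rightarrow> 'v \<Rightarrow> 'v \<Rightarrow> real) \<Rightarrow> 'e \<Rightarrow> 'e \<Rightarrow> 'e \<Rightarrow> real" where
  "form_in_chart c F \<omega> y a b =
     \<omega> (param c y) (chart_derivative c F (param c y) a) (chart_derivative c F (param c y) b)"

text \<open>
  A 2-form is closed if its exterior derivative vanishes in every chart; for the constant vector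
  fields \<^term>\<open>a\<close>, \<^term>\<open>b\<close>, \<^term>\<open>d\<close> of the chart the exterior derivative is the cyclic sum below.
\<close>

definition closed_two_form ::
  "('m, 'e::euclidean_space) chart set \<Rightarrow> ('m \<Rightarrow> 'v::euclidean_space)
     \<Rightarrow> ('m \<Rightarrow> 'v \<Rightarrow> 'v \<Rightarrow> real) \<Rightarrow> bool" where
  "closed_two_form \<A> F \<omega> \<longleftrightarrow> (\<forall>c\<in>\<A>. \<forall>x\<in>snd c ` fst c. \<forall>a b d.
       frechet_derivative (\<lambda>y. form_in_chart c F \<omega> y b d) (at x) a
     + frechet_derivative (\<lambda>y. form_in_chart c F \<omega> y d a) (at x) b
     + frechet_derivative (\<lambda>y. form_in_chart c F \<omega> y a b) (at x) d = 0)"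

definition kaehler ::
  "('m::topological_space, real^4) chart set \<Rightarrow> ('m \<Rightarrow> 'v::euclidean_space)
     \<Rightarrow> ('m \<Rightarrow> 'v \<Rightarrow> 'v) \<Rightarrow> bool" where
  "kaehler \<A> F \<J> \<longleftrightarrow> complex_structure \<A> F \<J> \<and> hermitian \<A> F \<J> \<and>
     closed_two_form \<A> F (\<lambda>p u v. \<J> p u \<bullet> v)"

end

theory Submission
  imports Defs
begin

text \<open>
  Put \<open>\<eta> = J dF\<close>, a 1-form on \<open>M\<close> with values in the ambient space; everything follows from
  \<open>d\<eta> = 0\<close>. The normal part of \<open>d\<eta>\<close> vanishes because matrices in \<open>Q_A\<close> anticommute with \<open>J\<close>.
  Its tangential part comes from \<open>\<nabla>J = \<tau> T + \<upsilon> U\<close> for two 1-forms \<open>\<tau>\<close> and \<open>\<upsilon>\<close>, and the normal part of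
  \<open>d(d\<eta>) = 0\<close> (a consequence of the Codazzi equation) reads \<open>[S,T] \<upsilon> = [S,U] \<tau>\<close> for all \<open>S\<close> in
  \<open>Q(p)\<close>, whence \<open>\<tau> = \<upsilon> = 0\<close> by the nullspace hypothesis.

  The Kaehler form is \<open>\<langle>\<eta>, dF\<rangle>\<close>, which is closed because \<open>\<eta>\<close> and \<open>dF\<close> are. Locally \<open>\<eta> = dG\<close>, and
  \<open>F - \<i> G\<close> is a holomorphic immersion into the complexified ambient space; two of its components
  are complex coordinates, so that the Newlander-Nirenberg theorem is not needed.
\<close>

subsection \<open>Calculus of smooth maps\<close>

text \<open>The hypotheses are algebraic conditions on II at single points, while the goal concerns
  the connection. Evaluating everything on constant coordinate fields of a chart, with values in the
  ambient space, replaces the Gauss and Codazzi equations by the symmetry of second derivatives: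
  brackets vanish and no curvature appears. The link to \<open>K_map\<close> is that a tangent field
  Z differentiated along X has normal part II(X,Z). Since d\<eta> is tangent, the normal part of
  d(d\<eta>) is the cyclic sum of II(e_k, d\<eta>(e_i,e_j)), linear in (\<tau>,\<upsilon>) with
  coefficients from S; a 3-form on a 4-space has four components, as many as \<open>K_map S\<close>
  has rows. The two conditions on Q(p) enter differently: membership in \<open>Q_A\<close> is used
  on an open set, because tangency of d\<eta> has to be differentiated, and the nullspace condition
  only at the point in question. Frames attached to different points may differ, but \<eta> depends
  on J and dF alone, so d\<eta> = 0 can be tested at each point with its own frame.\<close>

abbreviation dderiv :: "('a::real_normed_vector \<Rightarrow> 'b::real_normed_vector) \<Rightarrow> 'a \<Rightarrow> 'a \<Rightarrow> 'b" where
  "dderiv f v \<equiv> \<lambda>x. frechet_derivative f (at x) v"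

lemma dderiv_eqI: "(f has_derivative f') (at x) \<Longrightarrow> dderiv f v x = f' v"
  by (metis frechet_derivative_at)

lemma has_derivative_dderiv: "f differentiable (at x) \<Longrightarrow> (f has_derivative (\<lambda>v. dderiv f v x)) (at x)"
  using frechet_derivative_works by blast

lemma dderiv_cong_open:
  assumes "open S" "x \<in> S" "\<And>y. y \<in> S \<Longrightarrow> f y = g y"
  shows "dderiv f v x = dderiv g v x"
proof -
  have "(f has_derivative f') (at x) \<longleftrightarrow> (g has_derivative f') (at x)" for f'
    using assms by (metis has_derivative_transform_within_open)
  \<comment> \<open>\<open>frechet_derivative\<close> is a choice from the set of derivatives at the
    point, so equality of these sets suffices, even if they are empty.\<close>
  then show ?thesis unfolding frechet_derivative_def by simp
qed

lemma differentiable_cong_open: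
  assumes "open S" "x \<in> S" "\<And>y. y \<in> S \<Longrightarrow> f y = g y"
  shows "f differentiable (at x) \<longleftrightarrow> g differentiable (at x)"
  unfolding differentiable_def using assms by (metis has_derivative_transform_within_open)

section \<open>Locality and algebra of C^k and smooth maps\<close>

lemma C_k_on_cong:
  assumes "open S" "\<And>y. y \<in> S \<Longrightarrow> f y = g y"
  shows "C_k_on k S f \<longleftrightarrow> C_k_on k S g"
  using assms(2)
proof (induction k arbitrary: f g)
  case 0
  then show ?case using continuous_on_cong by auto
next
  case (Suc k)
  have "C_k_on k S (dderiv f v) \<longleftrightarrow> C_k_on k S (dderiv g v)" for v
    by (intro Suc.IH dderiv_cong_open[OF assms(1)]) (use Suc.prems in auto)
  moreover have "f differentiable (at x) \<longleftrightarrow> g differentiable (at x)" if "x \<in> S" for x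
    using differentiable_cong_open[OF assms(1) that] Suc.prems by blast
  ultimately show ?case by simp
qed

lemma C_k_on_subset: "C_k_on k S f \<Longrightarrow> S' \<subseteq> S \<Longrightarrow> C_k_on k S' f"
  by (induction k arbitrary: f) (auto intro: continuous_on_subset)

lemma C_k_on_local:
  assumes "\<And>x. x \<in> S \<Longrightarrow> \<exists>U. open U \<and> x \<in> U \<and> C_k_on k U f"
  shows "C_k_on k S f"
  using assms
proof (induction k arbitrary: f)
  case 0
  have "continuous (at x within S) f" if "x \<in> S" for x
    using 0[OF that] by (metis C_k_on.simps(1) continuous_at_imp_continuous_at_within continuous_on_eq_continuous_at)
  then show ?case by (simp add: continuous_on_eq_continuous_within)
next
  case (Suc k)
  have "C_k_on k S (dderiv f v)" for v
    by (rule Suc.IH) (use Suc.prems in force)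
  moreover have "f differentiable (at x)" if "x \<in> S" for x
    using Suc.prems[OF that] by auto
  ultimately show ?case by simp
qed

lemma C_k_on_Suc_imp: "C_k_on (Suc k) S f \<Longrightarrow> C_k_on k S f"
proof (induction k arbitrary: f)
  case 0
  then show ?case
    by (auto intro!: continuous_at_imp_continuous_on differentiable_imp_continuous_within)
qed simp

lemma C_k_on_const: "C_k_on k S (\<lambda>x. c)"
  by (induction k arbitrary: c) auto

lemma C_k_on_add:
  assumes "open S" "C_k_on k S f" "C_k_on k S g"
  shows "C_k_on k S (\<lambda>x. f x + g x)"
  using assms(2,3)
proof (induction k arbitrary: f g)
  case (Suc k)
  have "C_k_on k S (dderiv (\<lambda>x. f x + g x) v)" for v
  proof (subst C_k_on_cong[OF assms(1), where g = "\<lambda>x. dderiv f v x + dderiv g v x"])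
    show "dderiv (\<lambda>x. f x + g x) v x = dderiv f v x + dderiv g v x" if "x \<in> S" for x
      by (rule dderiv_eqI, rule has_derivative_add; rule has_derivative_dderiv)
        (use Suc.prems that in auto)
  qed (use Suc in auto)
  then show ?case using Suc.prems by (auto intro: differentiable_add)
qed (auto intro: continuous_intros)

lemma C_k_on_sum:
  assumes "open S" "\<And>i. i \<in> I \<Longrightarrow> C_k_on k S (f i)"
  shows "C_k_on k S (\<lambda>x. \<Sum>i\<in>I. f i x)"
  using assms(2)
  by (induction I rule: infinite_finite_induct) (auto simp: C_k_on_const intro: C_k_on_add assms(1))

text \<open>One induction via the product rule covers inner products and scalar multiples. The
  undifferentiated factors reappear one order lower, whence \<open>C_k_on_Suc_imp\<close>.\<close>

lemma C_k_on_bilinear: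
  assumes "bounded_bilinear h" "open S" "C_k_on k S f" "C_k_on k S g"
  shows "C_k_on k S (\<lambda>x. h (f x) (g x))"
  using assms(3,4)
proof (induction k arbitrary: f g)
  case 0
  then show ?case by (simp add: bounded_bilinear.continuous_on[OF assms(1)])
next
  case (Suc k)
  note D = bounded_bilinear.FDERIV[OF assms(1)]
  have "C_k_on k S (dderiv (\<lambda>x. h (f x) (g x)) v)" for v
  proof (subst C_k_on_cong[OF assms(2), where g = "\<lambda>x. h (f x) (dderiv g v x) + h (dderiv f v x) (g x)"])
    show "dderiv (\<lambda>x. h (f x) (g x)) v x = h (f x) (dderiv g v x) + h (dderiv f v x) (g x)"
      if "x \<in> S" for x
      by (rule dderiv_eqI, rule D; rule has_derivative_dderiv) (use Suc.prems that in auto)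
    show "C_k_on k S (\<lambda>x. h (f x) (dderiv g v x) + h (dderiv f v x) (g x))"
      by (intro C_k_on_add[OF assms(2)] Suc.IH)
        (use Suc.prems C_k_on_Suc_imp[of k S f] C_k_on_Suc_imp[of k S g] in auto)
  qed
  moreover have "(\<lambda>x. h (f x) (g x)) differentiable (at x)" if "x \<in> S" for x
    by (rule differentiableI, rule D; rule has_derivative_dderiv) (use Suc.prems that in auto)
  ultimately show ?case by simp
qed

lemma smooth_on_C_k: "smooth_on S f \<Longrightarrow> C_k_on k S f"
  by (simp add: smooth_on_def)

lemma smooth_on_dderiv: "smooth_on S f \<Longrightarrow> smooth_on S (dderiv f v)"
  unfolding smooth_on_def using C_k_on.simps(2) by blast

lemma smooth_on_differentiable: "smooth_on S f \<Longrightarrow> x \<in> S \<Longrightarrow> f differentiable (at x)"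
  using smooth_on_C_k[of S f "Suc 0"] by auto

lemma smooth_on_continuous: "smooth_on S f \<Longrightarrow> continuous_on S f"
  using smooth_on_C_k[of S f 0] by auto

lemma smooth_on_isCont: "open S \<Longrightarrow> smooth_on S f \<Longrightarrow> x \<in> S \<Longrightarrow> isCont f x"
  by (metis continuous_on_eq_continuous_at smooth_on_continuous)

text \<open>Bootstrapping for maps known through their derivative, such as those built from a
  primitive obtained by integration.\<close>

lemma smooth_onI_dderiv:
  assumes "\<And>x. x \<in> S \<Longrightarrow> f differentiable (at x)" "\<And>v. smooth_on S (dderiv f v)"
  shows "smooth_on S f"
proof -
  have "C_k_on (Suc k) S f" for k
    using assms by (simp add: smooth_on_def)
  then show ?thesis unfolding smooth_on_def using C_k_on_Suc_imp by blast
qed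

lemma smooth_on_cong: "open S \<Longrightarrow> (\<And>y. y \<in> S \<Longrightarrow> f y = g y) \<Longrightarrow> smooth_on S f \<longleftrightarrow> smooth_on S g"
  unfolding smooth_on_def using C_k_on_cong by metis

lemma smooth_on_subset: "smooth_on S f \<Longrightarrow> S' \<subseteq> S \<Longrightarrow> smooth_on S' f"
  unfolding smooth_on_def using C_k_on_subset by metis

lemma smooth_on_local:
  "(\<And>x. x \<in> S \<Longrightarrow> \<exists>U. open U \<and> x \<in> U \<and> smooth_on U f) \<Longrightarrow> smooth_on S f"
  unfolding smooth_on_def using C_k_on_local by metis

lemma smooth_on_const: "smooth_on S (\<lambda>x. c)"
  by (simp add: smooth_on_def C_k_on_const)

lemma smooth_on_sum:
  "open S \<Longrightarrow> (\<And>i. i \<in> I \<Longrightarrow> smooth_on S (f i)) \<Longrightarrow> smooth_on S (\<lambda>x. \<Sum>i\<in>I. f i x)"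
  by (simp add: smooth_on_def C_k_on_sum)

lemma smooth_on_inner:
  "open S \<Longrightarrow> smooth_on S f \<Longrightarrow> smooth_on S g \<Longrightarrow> smooth_on S (\<lambda>x. f x \<bullet> g x)"
  by (simp add: smooth_on_def C_k_on_bilinear bounded_bilinear_inner)

lemma smooth_on_scaleR:
  "open S \<Longrightarrow> smooth_on S f \<Longrightarrow> smooth_on S g \<Longrightarrow> smooth_on S (\<lambda>x. f x *\<^sub>R g x)"
  by (simp add: smooth_on_def C_k_on_bilinear bounded_bilinear_scaleR)

lemma smooth_on_add:
  "open S \<Longrightarrow> smooth_on S f \<Longrightarrow> smooth_on S g \<Longrightarrow> smooth_on S (\<lambda>x. f x + g x)"
  by (simp add: smooth_on_def C_k_on_add)

lemma smooth_on_minus: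
  assumes "open S" "smooth_on S f" shows "smooth_on S (\<lambda>x. - f x)"
  using smooth_on_scaleR[OF assms(1) smooth_on_const[of S "- 1"] assms(2)] by simp

lemma smooth_on_diff:
  "open S \<Longrightarrow> smooth_on S f \<Longrightarrow> smooth_on S g \<Longrightarrow> smooth_on S (\<lambda>x. f x - g x)"
  using smooth_on_add[of S f "\<lambda>x. - g x"] smooth_on_minus[of S g] by simp

lemma dderiv_linear: "f differentiable (at x) \<Longrightarrow> linear (\<lambda>v. dderiv f v x)"
  using linear_frechet_derivative by blast

lemma dderiv_inner:
  assumes "f differentiable (at x)" "g differentiable (at x)"
  shows "dderiv (\<lambda>x. f x \<bullet> g x) v x = f x \<bullet> dderiv g v x + dderiv f v x \<bullet> g x"
  by (rule dderiv_eqI, rule bounded_bilinear.FDERIV[OF bounded_bilinear_inner];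
      rule has_derivative_dderiv; fact)

lemma dderiv_scaleR:
  assumes "f differentiable (at x)" "g differentiable (at x)"
  shows "dderiv (\<lambda>x. f x *\<^sub>R g x) v x = f x *\<^sub>R dderiv g v x + dderiv f v x *\<^sub>R g x"
  by (rule dderiv_eqI, rule bounded_bilinear.FDERIV[OF bounded_bilinear_scaleR];
      rule has_derivative_dderiv; fact)

lemma dderiv_sum:
  assumes "\<And>i. i \<in> I \<Longrightarrow> f i differentiable (at x)"
  shows "dderiv (\<lambda>x. \<Sum>i\<in>I. f i x) v x = (\<Sum>i\<in>I. dderiv (f i) v x)"
  by (rule dderiv_eqI, rule has_derivative_sum, rule has_derivative_dderiv) (rule assms)

lemma dderiv_diff:
  assumes "f differentiable (at x)" "g differentiable (at x)"
  shows "dderiv (\<lambda>x. f x - g x) v x = dderiv f v x - dderiv g v x"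
  by (rule dderiv_eqI, rule has_derivative_diff; rule has_derivative_dderiv; fact)

section \<open>Symmetry of mixed second derivatives\<close>

lemma has_real_derivative_along_line:
  fixes f :: "'a::real_normed_vector \<Rightarrow> real"
  assumes "f differentiable (at (x + t *\<^sub>R v))"
  shows "((\<lambda>t. f (x + t *\<^sub>R v)) has_real_derivative dderiv f v (x + t *\<^sub>R v)) (at t)"
proof -
  have "((\<lambda>t. f (x + t *\<^sub>R v)) has_derivative (\<lambda>s. dderiv f (s *\<^sub>R v) (x + t *\<^sub>R v))) (at t)"
    by (rule has_derivative_compose[where f = "\<lambda>t. x + t *\<^sub>R v", OF _ has_derivative_dderiv[OF assms]])
       (auto intro!: derivative_eq_intros)
  moreover have "dderiv f (s *\<^sub>R v) (x + t *\<^sub>R v) = dderiv f v (x + t *\<^sub>R v) * s" for s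
    using linear_cmul[OF dderiv_linear[OF assms], of s v] by simp
  ultimately show ?thesis by (simp add: has_field_derivative_def)
qed

text \<open>Two mean value theorems: along \<open>u\<close> for the increment of \<open>f\<close>
  across \<open>s *\<^sub>R v\<close>, then along \<open>v\<close> for the derivative in direction
  \<open>u\<close>. The second difference is symmetric in \<open>u\<close> and \<open>v\<close>, so
  exchanging them compares both mixed derivatives at nearby points.\<close>

lemma mixed_difference:
  fixes f :: "'a::real_normed_vector \<Rightarrow> real"
  assumes "smooth_on S f" "0 < s"
    and S: "\<And>\<xi> \<eta>. \<xi> \<in> {0..s} \<Longrightarrow> \<eta> \<in> {0..s} \<Longrightarrow> x + \<xi> *\<^sub>R u + \<eta> *\<^sub>R v \<in> S"
  obtains \<xi> \<eta> where "\<xi> \<in> {0..s}" "\<eta> \<in> {0..s}"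
    "f (x + s *\<^sub>R u + s *\<^sub>R v) - f (x + s *\<^sub>R u) - f (x + s *\<^sub>R v) + f x
       = s * s * dderiv (dderiv f u) v (x + \<xi> *\<^sub>R u + \<eta> *\<^sub>R v)"
proof -
  define h where "h t = f ((x + s *\<^sub>R v) + t *\<^sub>R u) - f (x + t *\<^sub>R u)" for t
  have S': "(x + s *\<^sub>R v) + t *\<^sub>R u \<in> S" "x + t *\<^sub>R u \<in> S" if "t \<in> {0..s}" for t
    using S[OF that, of s] S[OF that, of 0] assms(2) by (auto simp: algebra_simps)
  have "(h has_real_derivative dderiv f u ((x + s *\<^sub>R v) + t *\<^sub>R u) - dderiv f u (x + t *\<^sub>R u)) (at t)"
    if "0 \<le> t" "t \<le> s" for t
    unfolding h_def
    by (intro derivative_intros has_real_derivative_along_line smooth_on_differentiable[OF assms(1)] S')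
      (use that in auto)
  from MVT2[OF assms(2) this] obtain \<xi> where \<xi>: "0 < \<xi>" "\<xi> < s"
    "h s - h 0 = (s - 0) * (dderiv f u ((x + s *\<^sub>R v) + \<xi> *\<^sub>R u) - dderiv f u (x + \<xi> *\<^sub>R u))"
    by blast
  have "((\<lambda>t. dderiv f u ((x + \<xi> *\<^sub>R u) + t *\<^sub>R v)) has_real_derivative
     dderiv (dderiv f u) v ((x + \<xi> *\<^sub>R u) + t *\<^sub>R v)) (at t)"
    if "0 \<le> t" "t \<le> s" for t
    by (intro has_real_derivative_along_line smooth_on_differentiable[OF smooth_on_dderiv, OF assms(1)] S)
      (use that \<xi> in auto)
  from MVT2[OF assms(2) this] obtain \<eta> where "0 < \<eta>" "\<eta> < s"
    "dderiv f u ((x + \<xi> *\<^sub>R u) + s *\<^sub>R v) - dderiv f u ((x + \<xi> *\<^sub>R u) + 0 *\<^sub>R v)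
      = (s - 0) * dderiv (dderiv f u) v ((x + \<xi> *\<^sub>R u) + \<eta> *\<^sub>R v)"
    by blast
  with \<xi> show ?thesis
    by (intro that[of \<xi> \<eta>]) (auto simp: h_def algebra_simps)
qed

lemma dderiv_commute_real:
  fixes f :: "'a::real_normed_vector \<Rightarrow> real"
  assumes "open S" "smooth_on S f" "x \<in> S"
  shows "dderiv (dderiv f u) v x = dderiv (dderiv f v) u x"
proof (rule ccontr)
  let ?g = "dderiv (dderiv f u) v" and ?h = "dderiv (dderiv f v) u"
  assume "?g x \<noteq> ?h x"
  then have \<epsilon>: "\<bar>?g x - ?h x\<bar> / 2 > 0" (is "?\<epsilon> > 0") by simp
  have "continuous (at x) ?g" "continuous (at x) ?h"
    using assms by (auto intro: smooth_on_isCont smooth_on_dderiv)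
  from this[unfolded continuous_at_eps_delta] \<epsilon>
  obtain d1 d2 where d: "d1 > 0" "d2 > 0"
    and g: "\<And>y. dist y x < d1 \<Longrightarrow> dist (?g y) (?g x) < ?\<epsilon>"
    and h: "\<And>y. dist y x < d2 \<Longrightarrow> dist (?h y) (?h x) < ?\<epsilon>" by blast
  obtain d3 where d3: "d3 > 0" "ball x d3 \<subseteq> S" using assms openE by blast
  define d where "d = min d1 (min d2 d3)"
  have "d > 0" using d d3 by (simp add: d_def)
  \<comment> \<open>The summand 1 keeps \<open>N\<close> positive for vanishing \<open>u\<close>,
    \<open>v\<close>; the 2 in \<open>s\<close> bounds displacements by d/2, strictly below
    d.\<close>
  define N where "N = norm u + norm v + 1"
  define s where "s = d / (2 * N)"
  have pos: "N > 0" unfolding N_def by (smt (verit) norm_ge_zero)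
  have s: "s > 0" using \<open>d > 0\<close> pos by (simp add: s_def)
  have near: "dist (x + \<xi> *\<^sub>R u + \<eta> *\<^sub>R v) x < d" if "\<xi> \<in> {0..s}" "\<eta> \<in> {0..s}" for \<xi> \<eta>
  proof -
    have "norm (\<xi> *\<^sub>R u + \<eta> *\<^sub>R v) \<le> \<bar>\<xi>\<bar> * norm u + \<bar>\<eta>\<bar> * norm v"
      by (metis norm_scaleR norm_triangle_ineq)
    also have "\<dots> \<le> s * norm u + s * norm v"
      using that by (intro add_mono mult_right_mono) auto
    also have "\<dots> \<le> s * N" using s by (simp add: N_def algebra_simps)
    also have "\<dots> = d / 2" using pos by (simp add: s_def)
    finally show ?thesis using \<open>d > 0\<close> by (simp add: dist_norm add.assoc)
  qed
  then have S: "x + \<xi> *\<^sub>R u + \<eta> *\<^sub>R v \<in> S" if "\<xi> \<in> {0..s}" "\<eta> \<in> {0..s}" for \<xi> \<eta>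
    using d3 that by (force simp: d_def dist_commute)
  then have S': "x + \<xi> *\<^sub>R v + \<eta> *\<^sub>R u \<in> S" if "\<xi> \<in> {0..s}" "\<eta> \<in> {0..s}" for \<xi> \<eta>
    using that by (metis add.assoc add.commute)
  obtain \<xi> \<eta> where 1: "\<xi> \<in> {0..s}" "\<eta> \<in> {0..s}"
    "f (x + s *\<^sub>R u + s *\<^sub>R v) - f (x + s *\<^sub>R u) - f (x + s *\<^sub>R v) + f x = s * s * ?g (x + \<xi> *\<^sub>R u + \<eta> *\<^sub>R v)"
    by (rule mixed_difference[OF assms(2) s S])
  obtain \<xi>' \<eta>' where 2: "\<xi>' \<in> {0..s}" "\<eta>' \<in> {0..s}"
    "f (x + s *\<^sub>R v + s *\<^sub>R u) - f (x + s *\<^sub>R v) - f (x + s *\<^sub>R u) + f x = s * s * ?h (x + \<xi>' *\<^sub>R v + \<eta>' *\<^sub>R u)"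
    by (rule mixed_difference[OF assms(2) s S'])
  have eq: "x + s *\<^sub>R v + s *\<^sub>R u = x + s *\<^sub>R u + s *\<^sub>R v" by simp
  have "s * s * ?g (x + \<xi> *\<^sub>R u + \<eta> *\<^sub>R v) = s * s * ?h (x + \<xi>' *\<^sub>R v + \<eta>' *\<^sub>R u)"
    using 1(3) 2(3) unfolding eq by linarith
  then have "?g (x + \<xi> *\<^sub>R u + \<eta> *\<^sub>R v) = ?h (x + \<xi>' *\<^sub>R v + \<eta>' *\<^sub>R u)"
    using s by simp
  moreover have "dist (?g (x + \<xi> *\<^sub>R u + \<eta> *\<^sub>R v)) (?g x) < ?\<epsilon>"
    using near[OF 1(1,2)] by (intro g) (simp add: d_def)
  moreover have "dist (?h (x + \<xi>' *\<^sub>R v + \<eta>' *\<^sub>R u)) (?h x) < ?\<epsilon>"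
    using near[OF 2(2,1)] by (intro h) (simp add: d_def add.commute add.left_commute)
  moreover have False
    if "a = b" "dist a g < \<bar>g - h\<bar> / 2" "dist b h < \<bar>g - h\<bar> / 2" for a b g h :: real
    using that dist_triangle_half_r[of a g "\<bar>g - h\<bar>" h] by (simp add: dist_real_def)
  ultimately show False by blast
qed

lemma dderiv_inner_const:
  assumes "f differentiable (at x)"
  shows "dderiv (\<lambda>x. f x \<bullet> w) v x = dderiv f v x \<bullet> w"
  using dderiv_inner[OF assms differentiable_const] by simp

lemma dderiv_commute:
  fixes f :: "'a::real_normed_vector \<Rightarrow> 'b::euclidean_space"
  assumes "open S" "smooth_on S f" "x \<in> S"
  shows "dderiv (dderiv f u) v x = dderiv (dderiv f v) u x"
proof (rule euclidean_eqI)
  fix b :: 'b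
  assume "b \<in> Basis"
  have *: "dderiv (dderiv (\<lambda>x. f x \<bullet> b) u) v x = dderiv (dderiv f u) v x \<bullet> b" for u v
  proof -
    have "dderiv (dderiv (\<lambda>x. f x \<bullet> b) u) v x = dderiv (\<lambda>x. dderiv f u x \<bullet> b) v x"
      by (rule dderiv_cong_open[OF assms(1,3)], rule dderiv_inner_const)
        (use assms smooth_on_differentiable in blast)
    also have "\<dots> = dderiv (dderiv f u) v x \<bullet> b"
      by (rule dderiv_inner_const) (use assms smooth_on_differentiable smooth_on_dderiv in blast)
    finally show ?thesis .
  qed
  have "smooth_on S (\<lambda>x. f x \<bullet> b)"
    by (intro smooth_on_inner smooth_on_const assms)
  from dderiv_commute_real[OF assms(1) this assms(3), of u v]
  show "dderiv (dderiv f u) v x \<bullet> b = dderiv (dderiv f v) u x \<bullet> b" unfolding * .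
qed

subsection \<open>Closed 1-forms and local injectivity\<close>

lemma linear_expand_Basis:
  fixes h :: "'a::euclidean_space \<Rightarrow> 'b::real_vector"
  assumes "linear h"
  shows "h w = (\<Sum>i\<in>Basis. (w \<bullet> i) *\<^sub>R h i)"
proof -
  have "h w = h (\<Sum>i\<in>Basis. (w \<bullet> i) *\<^sub>R i)" by (simp add: euclidean_representation)
  also have "\<dots> = (\<Sum>i\<in>Basis. (w \<bullet> i) *\<^sub>R h i)"
    by (simp only: linear_sum[OF assms] linear_cmul[OF assms])
  finally show ?thesis .
qed

text \<open>The primitive is the radial integral of the form at c + t(x - c), applied to x - c, over
  t in [0,1]. Closedness makes the derivative of the integrand in direction v equal to the
  t-derivative of t times the form on v.\<close>

lemma poincare_lemma_one_form:
  fixes \<eta> :: "'a::euclidean_space \<Rightarrow> 'a \<Rightarrow> 'b::euclidean_space"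
  assumes S: "open S" "convex S" "c \<in> S"
    and sm: "\<And>b. smooth_on S (\<eta> b)"
    and lin: "\<And>y. y \<in> S \<Longrightarrow> linear (\<lambda>b. \<eta> b y)"
    and closed: "\<And>a b y. y \<in> S \<Longrightarrow> dderiv (\<eta> b) a y = dderiv (\<eta> a) b y"
  obtains G where "\<And>y. y \<in> S \<Longrightarrow> (G has_derivative (\<lambda>b. \<eta> b y)) (at y)"
proof -
  define q where "q x t = c + t *\<^sub>R (x - c)" for x and t :: real
  define g where "g x t = (\<Sum>i\<in>Basis. ((x - c) \<bullet> i) *\<^sub>R \<eta> i (q x t))" for x t
  define g' where "g' x t v = (\<Sum>i\<in>Basis. (v \<bullet> i) *\<^sub>R \<eta> i (q x t)
      + ((x - c) \<bullet> i) *\<^sub>R (t *\<^sub>R dderiv (\<eta> i) v (q x t)))" for x t v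
  have q: "q x t \<in> S" if "x \<in> S" "t \<in> {0..1}" for x t
  proof -
    have "q x t = (1 - t) *\<^sub>R c + t *\<^sub>R x" by (simp add: q_def algebra_simps)
    then show ?thesis using that S by (simp add: convex_alt)
  qed
  have diff: "\<eta> b differentiable (at y)" if "y \<in> S" for b y
    using smooth_on_differentiable[OF sm that] .
  have der: "((\<lambda>x. g x t) has_derivative g' x t) (at x within S)" if x: "x \<in> S" "t \<in> {0..1}" for x t
  proof -
    have "((\<lambda>x. \<eta> i (q x t)) has_derivative (\<lambda>v. dderiv (\<eta> i) (t *\<^sub>R v) (q x t))) (at x within S)" for i
      by (rule has_derivative_compose[where f = "\<lambda>x. q x t", OF _ has_derivative_dderiv[OF diff[OF q[OF x]]]])
        (auto simp: q_def intro!: derivative_eq_intros)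
    then have *: "((\<lambda>x. \<eta> i (q x t)) has_derivative (\<lambda>v. t *\<^sub>R dderiv (\<eta> i) v (q x t))) (at x within S)" for i
      by (simp add: linear_cmul[OF dderiv_linear[OF diff[OF q[OF x]]]])
    show ?thesis unfolding g_def g'_def
      by (rule has_derivative_sum) (auto intro!: derivative_eq_intros *)
  qed
  have bl: "bounded_linear (g' x t)" if "x \<in> S" "t \<in> {0..1}" for x t
    using der[OF that] by (rule has_derivative_bounded_linear)
  have "continuous_on (S \<times> {0..1}) (\<lambda>z. q (fst z) (snd z))"
    unfolding q_def by (intro continuous_intros)
  then have cont_q: "continuous_on (S \<times> {0..1}) (\<lambda>z. h (q (fst z) (snd z)))"
    if "continuous_on S h" for h :: "'a \<Rightarrow> 'b"
    by (rule continuous_on_compose2[OF that]) (auto intro!: q)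
  \<comment> \<open>Leibniz's rule needs a continuous operator-valued derivative; in finite
    dimension continuity can be tested on each vector.\<close>
  have cont_g': "continuous_on (S \<times> {0..1}) (\<lambda>(x, t). Blinfun (g' x t))"
  proof (rule continuous_on_blinfun_componentwise)
    fix v :: 'a
    have "continuous_on (S \<times> {0..1}) (\<lambda>z. g' (fst z) (snd z) v)"
      unfolding g'_def
      by (intro continuous_intros cont_q smooth_on_continuous smooth_on_dderiv sm)
    then show "continuous_on (S \<times> {0..1}) (\<lambda>z. blinfun_apply (case z of (x, t) \<Rightarrow> Blinfun (g' x t)) v)"
      by (rule continuous_on_eq) (auto simp: bounded_linear_Blinfun_apply bl)
  qed
  have cont1: "continuous_on {0..1} (\<lambda>t. h (q x t))" if "x \<in> S" "continuous_on S h" for x and h :: "'a \<Rightarrow> 'b"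
  proof (rule continuous_on_compose2[OF that(2)])
    show "continuous_on {0..1} (q x)" unfolding q_def by (intro continuous_intros)
  qed (use q that(1) in auto)
  define G where "G x = integral (cbox 0 1) (g x)" for x
  show ?thesis
  proof
    fix x assume x: "x \<in> S"
    have "(G has_derivative integral (cbox 0 1) (\<lambda>t. Blinfun (g' x t))) (at x within S)"
      unfolding G_def
    proof (rule leibniz_rule[OF _ _ _ x S(2)])
      show "((\<lambda>x. g x t) has_derivative blinfun_apply (Blinfun (g' x t))) (at x within S)"
        if "x \<in> S" "t \<in> cbox 0 1" for x t
        using der that by (simp add: bounded_linear_Blinfun_apply bl)
      show "g y integrable_on cbox 0 1" if "y \<in> S" for y
        unfolding g_def
        by (intro integrable_continuous continuous_intros)
          (use cont1[OF that] smooth_on_continuous[OF sm] in auto)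
    qed (use cont_g' in simp)
    moreover have "blinfun_apply (integral (cbox 0 1) (\<lambda>t. Blinfun (g' x t))) = (\<lambda>v. \<eta> v x)"
    proof
      fix v
      have "continuous_on {0..1} (\<lambda>t. case (x, t) of (x, t) \<Rightarrow> Blinfun (g' x t))"
        by (rule continuous_on_compose2[OF cont_g'])
          (auto intro!: continuous_on_Pair continuous_on_const continuous_on_id x)
      then have "(\<lambda>t. Blinfun (g' x t)) integrable_on cbox 0 1"
        by (intro integrable_continuous) simp
      then have "integral (cbox 0 1) (\<lambda>t. Blinfun (g' x t)) v = integral (cbox 0 1) (\<lambda>t. Blinfun (g' x t) v)"
        by (rule blinfun_apply_integral)
      also have "\<dots> = integral {0..1} (\<lambda>t. g' x t v)"
        by (auto intro!: integral_cong simp: bounded_linear_Blinfun_apply bl x)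
      \<comment> \<open>The factor t removes the value at the centre and leaves the form at
        \<open>x\<close>.\<close>
      also have "\<dots> = 1 *\<^sub>R \<eta> v (q x 1) - 0 *\<^sub>R \<eta> v (q x 0)"
      proof (rule integral_unique, rule fundamental_theorem_of_calculus)
        fix t :: real assume t: "t \<in> {0..1}"
        note y = q[OF x t]
        have "(\<Sum>i\<in>Basis. (v \<bullet> i) *\<^sub>R \<eta> i (q x t)) = \<eta> v (q x t)"
          by (rule linear_expand_Basis[OF lin[OF y], of v, symmetric])
        \<comment> \<open>Closedness exchanges \<open>i\<close> and \<open>v\<close>, after which
          the basis sum reassembles the direction \<open>x - c\<close>.\<close>
        moreover have "(\<Sum>i\<in>Basis. ((x - c) \<bullet> i) *\<^sub>R dderiv (\<eta> i) v (q x t)) = dderiv (\<eta> v) (x - c) (q x t)"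
          by (simp only: closed[OF y, of _ v] linear_expand_Basis[OF dderiv_linear[OF diff[OF y, of v]], of "x - c"])
        ultimately have g'_eq: "g' x t v = \<eta> v (q x t) + t *\<^sub>R dderiv (\<eta> v) (x - c) (q x t)"
          unfolding g'_def
          by (simp only: sum.distrib scaleR_left_commute[of _ t] scaleR_right.sum[symmetric])
        have "((\<lambda>t. \<eta> v (q x t)) has_derivative (\<lambda>s. dderiv (\<eta> v) (s *\<^sub>R (x - c)) (q x t))) (at t within {0..1})"
          by (rule has_derivative_compose[where f = "\<lambda>t. q x t", OF _ has_derivative_dderiv[OF diff[OF y]]])
            (auto simp: q_def intro!: derivative_eq_intros)
        then have *: "((\<lambda>t. \<eta> v (q x t)) has_vector_derivative dderiv (\<eta> v) (x - c) (q x t)) (at t within {0..1})"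
          unfolding has_vector_derivative_def
          by (simp add: linear_cmul[OF dderiv_linear[OF diff[OF y]]])
        show "((\<lambda>t. t *\<^sub>R \<eta> v (q x t)) has_vector_derivative g' x t v) (at t within {0..1})"
          unfolding g'_eq by (auto intro!: derivative_eq_intros *)
      qed simp
      finally show "integral (cbox 0 1) (\<lambda>t. Blinfun (g' x t)) v = \<eta> v x" by (simp add: q_def)
    qed
    ultimately show "(G has_derivative (\<lambda>b. \<eta> b x)) (at x)"
      by (simp add: at_within_open[OF x S(1)])
  qed
qed

lemma smooth_on_onorm_dderiv:
  fixes f :: "'a::euclidean_space \<Rightarrow> 'b::real_normed_vector"
  assumes "open S" "smooth_on S f" "x \<in> S" "\<epsilon> > 0"
  shows "\<exists>d>0. \<forall>y. dist x y < d \<longrightarrow> onorm (\<lambda>v. dderiv f v y - dderiv f v x) < \<epsilon>"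
proof -
  have bl: "bounded_linear (\<lambda>v. dderiv f v y)" if "y \<in> S" for y
    using dderiv_linear[OF smooth_on_differentiable[OF assms(2) that]] linear_conv_bounded_linear by blast
  have "continuous_on S (\<lambda>y. Blinfun (\<lambda>v. dderiv f v y))"
  proof (rule continuous_on_blinfun_componentwise)
    fix v :: 'a
    have "continuous_on S (\<lambda>y. dderiv f v y)"
      by (intro smooth_on_continuous smooth_on_dderiv assms)
    then show "continuous_on S (\<lambda>y. blinfun_apply (Blinfun (\<lambda>v. dderiv f v y)) v)"
      by (rule continuous_on_eq) (auto simp: bounded_linear_Blinfun_apply bl)
  qed
  then have "isCont (\<lambda>y. Blinfun (\<lambda>v. dderiv f v y)) x"
    using assms continuous_on_eq_continuous_at by blast
  then obtain d1 where d1: "d1 > 0"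
    "\<And>y. dist y x < d1 \<Longrightarrow> dist (Blinfun (\<lambda>v. dderiv f v y)) (Blinfun (\<lambda>v. dderiv f v x)) < \<epsilon>"
    unfolding continuous_at_eps_delta using assms(4) by blast
  obtain d2 where d2: "d2 > 0" "ball x d2 \<subseteq> S" using assms openE by blast
  have "onorm (\<lambda>v. dderiv f v y - dderiv f v x) < \<epsilon>" if "dist x y < min d1 d2" for y
  proof -
    have "y \<in> S" using that d2 by auto
    then have "blinfun_apply (Blinfun (\<lambda>v. dderiv f v y) - Blinfun (\<lambda>v. dderiv f v x))
        = (\<lambda>v. dderiv f v y - dderiv f v x)"
      by (simp add: fun_eq_iff blinfun.diff_left bounded_linear_Blinfun_apply bl assms)
    then show ?thesis
      using d1(2)[of y] that by (simp add: dist_norm norm_blinfun.rep_eq norm_minus_commute)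
  qed
  then show ?thesis using d1 d2 by (intro exI[of _ "min d1 d2"]) auto
qed

text \<open>The differential stays injective nearby: if a left inverse of it at \<open>x\<close> is
  bounded by \<open>B\<close>, a perturbation of operator norm below 1/B cannot annihilate a nonzero
  vector.\<close>

lemma smooth_on_locally_injective:
  fixes f :: "'a::euclidean_space \<Rightarrow> 'b::euclidean_space"
  assumes S: "open S" "smooth_on S f" "x \<in> S" and inj: "inj (\<lambda>v. dderiv f v x)"
  obtains r where "r > 0" "ball x r \<subseteq> S" "inj_on f (ball x r)"
    "\<And>y. y \<in> ball x r \<Longrightarrow> inj (\<lambda>v. dderiv f v y)"
proof -
  have lin: "linear (\<lambda>v. dderiv f v y)" if "y \<in> S" for y
    using dderiv_linear[OF smooth_on_differentiable[OF S(2) that]] .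
  obtain g where g: "linear g" "g \<circ> (\<lambda>v. dderiv f v x) = id"
    using linear_injective_left_inverse[OF lin[OF S(3)] inj] by blast
  obtain r1 where r1: "r1 > 0" "ball x r1 \<subseteq> S" "inj_on f (ball x r1)"
  proof (rule has_derivative_locally_injective[where f = f and f' = "\<lambda>y v. dderiv f v y", OF S(3,1) _ g(2)])
    show "bounded_linear g" using g(1) by (simp add: linear_conv_bounded_linear)
    show "(f has_derivative (\<lambda>v. dderiv f v y)) (at y)" if "y \<in> S" for y
      by (rule has_derivative_dderiv[OF smooth_on_differentiable[OF S(2) that]])
  qed (rule smooth_on_onorm_dderiv[OF S])
  obtain B where B: "B > 0" "\<And>v. norm (g v) \<le> B * norm v"
    using linear_bounded_pos[OF g(1)] by blast
  obtain d where d: "d > 0" "\<And>y. dist x y < d \<Longrightarrow> onorm (\<lambda>v. dderiv f v y - dderiv f v x) < 1 / B"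
    using smooth_on_onorm_dderiv[OF S, of "1 / B"] B by auto
  show ?thesis
  proof (rule that[of "min r1 d"])
    show "inj (\<lambda>v. dderiv f v y)" if y: "y \<in> ball x (min r1 d)" for y
    proof -
      have yS: "y \<in> S" using y r1 by auto
      have "v = 0" if v: "dderiv f v y = 0" for v
      proof (rule ccontr)
        assume "v \<noteq> 0"
        have bl: "bounded_linear (\<lambda>v. dderiv f v y - dderiv f v x)"
          using linear_compose_sub[OF lin[OF yS] lin[OF S(3)]] by (simp add: linear_conv_bounded_linear)
        have "norm v = norm (g (dderiv f v x))"
          using fun_cong[OF g(2), of v] by simp
        also have "\<dots> \<le> B * norm (dderiv f v y - dderiv f v x)"
          using B(2)[of "dderiv f v x"] v by simp
        also have "\<dots> \<le> B * (onorm (\<lambda>v. dderiv f v y - dderiv f v x) * norm v)"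
          using onorm[OF bl, of v] B(1) by (intro mult_left_mono) auto
        also have "\<dots> < B * (1 / B * norm v)"
          using d(2)[of y] y B(1) \<open>v \<noteq> 0\<close> by (intro mult_strict_left_mono mult_strict_right_mono) auto
        also have "\<dots> = norm v" using B(1) by simp
        finally show False by simp
      qed
      then show ?thesis using linear_injective_0[OF lin[OF yS]] by blast
    qed
  qed (use r1 d in \<open>auto intro: inj_on_subset\<close>)
qed

subsection \<open>The Codazzi argument in a chart\<close>

lemma Q_A_entries:
  fixes S :: "real^4^4"
  assumes "S \<in> Q_A"
  shows "S$2$1 = S$1$2" "S$3$1 = S$1$3" "S$3$2 = S$1$4" "S$4$1 = S$1$4" "S$2$3 = S$1$4" "S$4$2 = S$2$4"
    "S$3$3 = - S$1$1" "S$3$4 = - S$1$2" "S$4$3 = - S$1$2" "S$4$4 = - S$2$2"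
proof -
  from assms obtain A B :: "real^2^2" where S: "S = vector [vector [A$1$1, A$1$2, B$1$1, B$1$2],
                  vector [A$2$1, A$2$2, B$2$1, B$2$2],
                  vector [B$1$1, B$1$2, - A$1$1, - A$1$2],
                  vector [B$2$1, B$2$2, - A$2$1, - A$2$2]]" and "transpose A = A" "transpose B = B"
    unfolding Q_A_def by blast
  moreover have "transpose C $ 1 $ 2 = C $ 2 $ 1" for C :: "real^2^2"
    by (simp add: transpose_def)
  ultimately have "A$2$1 = A$1$2" "B$2$1 = B$1$2"
    by metis+
  then show "S$2$1 = S$1$2" "S$3$1 = S$1$3" "S$3$2 = S$1$4" "S$4$1 = S$1$4" "S$2$3 = S$1$4" "S$4$2 = S$2$4"
    "S$3$3 = - S$1$1" "S$3$4 = - S$1$2" "S$4$3 = - S$1$2" "S$4$4 = - S$2$2"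
    by (simp_all add: S)
qed

lemma mult_J_mat [simp]:
  "(J_mat *v x) $ 1 = - (x $ 3)" "(J_mat *v x) $ 2 = - (x $ 4)"
  "(J_mat *v x) $ 3 = x $ 1" "(J_mat *v x) $ 4 = x $ 2"
  by (simp_all add: matrix_vector_mult_def sum_4 J_mat_def)

lemma TU_entries [simp]:
  "T_mat$1 = vector [0, - 1, 0, 0]" "T_mat$2 = vector [1, 0, 0, 0]"
  "T_mat$3 = vector [0, 0, 0, 1]" "T_mat$4 = vector [0, 0, - 1, 0]"
  "U_mat$1 = vector [0, 0, 0, 1]" "U_mat$2 = vector [0, 0, - 1, 0]"
  "U_mat$3 = vector [0, 1, 0, 0]" "U_mat$4 = vector [- 1, 0, 0, 0]"
  by (simp_all add: T_mat_def U_mat_def)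

text \<open>Both sides are values of the bilinear form S(x, J y). As S is symmetric, J is skew and
  SJ = -JS, the matrix SJ is symmetric.\<close>

lemma Q_A_J_symmetric:
  fixes S :: "real^4^4" and x y :: "real^4"
  assumes "S \<in> Q_A"
  shows "(\<Sum>i\<in>UNIV. \<Sum>k\<in>UNIV. (J_mat *v y) $ i * (x $ k) * S $ k $ i)
       = (\<Sum>i\<in>UNIV. \<Sum>k\<in>UNIV. (J_mat *v x) $ i * (y $ k) * S $ k $ i)"
  by (simp add: sum_4 Q_A_entries[OF assms] algebra_simps)

lemma K_map_mult:
  "(K_map S *v (\<chi> j. case j of Inl k \<Rightarrow> u k | Inr k \<Rightarrow> - t k)) $ i
    = (\<Sum>k\<in>UNIV. commutator S T_mat $ i $ k * u k) - (\<Sum>k\<in>UNIV. commutator S U_mat $ i $ k * t k)"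
proof -
  have "(\<Sum>j\<in>UNIV. h j) = (\<Sum>k\<in>UNIV. h (Inl k)) + (\<Sum>k\<in>UNIV. h (Inr k))" for h :: "4 + 4 \<Rightarrow> real"
  proof -
    have "(\<Sum>j\<in>UNIV. h j) = (\<Sum>j\<in>range Inl \<union> range Inr. h j)"
      by (simp add: UNIV_sum)
    also have "\<dots> = (\<Sum>j\<in>range Inl. h j) + (\<Sum>j\<in>range Inr. h j)"
      by (rule sum.union_disjoint) auto
    finally show ?thesis by (simp add: sum.reindex)
  qed
  then show ?thesis
    by (simp add: matrix_vector_mult_def K_map_def sum_negf)
qed

text \<open>The hypothesis is the normal part of \<open>d(d(J dF)) = 0\<close>; its four independent components are,
  up to sign and order, the rows of the conclusion.\<close>

lemma K_map_null_of_cyclic: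
  fixes S :: "real^4^4" and t u :: "4 \<Rightarrow> real"
  defines "N \<equiv> \<lambda>i l j. t i * T_mat $ l $ j + u i * U_mat $ l $ j"
  assumes S: "S \<in> Q_A"
    and cyc: "\<And>i j k. (\<Sum>l\<in>UNIV. S $ k $ l * (N i l j - N j l i)) + (\<Sum>l\<in>UNIV. S $ i $ l * (N j l k - N k l j))
      + (\<Sum>l\<in>UNIV. S $ j $ l * (N k l i - N i l k)) = 0"
  shows "K_map S *v (\<chi> j. case j of Inl k \<Rightarrow> u k | Inr k \<Rightarrow> - t k) = 0"
  unfolding vec_eq_iff forall_4 K_map_mult
  \<comment> \<open>The cyclic sum is alternating in i, j, k, so these four triples carry all its
    information.\<close>
  using cyc[of 1 2 3] cyc[of 1 2 4] cyc[of 1 3 4] cyc[of 2 3 4]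
  by (simp add: commutator_def matrix_matrix_mult_def sum_4 N_def Q_A_entries[OF S] algebra_simps)

lemma orthonormal_expansion:
  fixes b :: "'i::finite \<Rightarrow> 'v::euclidean_space"
  assumes "\<And>i j. b i \<bullet> b j = (if i = j then 1 else 0)" "w \<in> span (range b)"
  shows "w = (\<Sum>i\<in>UNIV. (w \<bullet> b i) *\<^sub>R b i)"
  using assms(2)
proof (induction rule: span_induct_alt)
  case base
  then show ?case by simp
next
  case (step c x y)
  then obtain j where j: "x = b j" by blast
  have "(\<Sum>i\<in>UNIV. (x \<bullet> b i) *\<^sub>R b i) = x"
    by (simp add: j assms(1) if_distrib[of "\<lambda>c. c *\<^sub>R _"] cong: if_cong)
  moreover have "(\<Sum>i\<in>UNIV. ((c *\<^sub>R x + y) \<bullet> b i) *\<^sub>R b i)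
      = c *\<^sub>R (\<Sum>i\<in>UNIV. (x \<bullet> b i) *\<^sub>R b i) + (\<Sum>i\<in>UNIV. (y \<bullet> b i) *\<^sub>R b i)"
    by (simp add: inner_add_left scaleR_add_left sum.distrib scaleR_right.sum)
  ultimately show ?case using step by simp
qed

section \<open>Moving frames over a coordinate domain\<close>

locale adapted_coordinates =
  fixes S :: "'a::euclidean_space set" and f :: "'a \<Rightarrow> 'v::euclidean_space" and e :: "4 \<Rightarrow> 'a \<Rightarrow> 'v"
  assumes S: "open S"
    and f: "smooth_on S f"
    and e: "\<And>i. smooth_on S (e i)"
    and orthonormal: "\<And>x i j. x \<in> S \<Longrightarrow> e i x \<bullet> e j x = (if i = j then 1 else 0)"
    and tangent: "\<And>x. x \<in> S \<Longrightarrow> span (range (\<lambda>i. e i x)) = range (\<lambda>a. dderiv f a x)"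
    and inj: "\<And>x. x \<in> S \<Longrightarrow> inj (\<lambda>a. dderiv f a x)"
begin

text \<open>Chart version of Q(p). \<open>A i\<close> holds the coordinates of the i-th frame
  vector, and the frame field \<open>e j\<close> serves as tangent extension of its own value, so
  the entries are those of \<nu> paired with II(e_i,e_j).\<close>

definition forms :: "'a \<Rightarrow> (real^4^4) set" where
  "forms x = {\<chi> i j. \<nu> \<bullet> dderiv (e j) (A i) x | \<nu> A.
     (\<forall>i. \<nu> \<bullet> e i x = 0) \<and> (\<forall>i. dderiv f (A i) x = e i x)}"

definition J_form :: "'a \<Rightarrow> 'a \<Rightarrow> 'v" where
  "J_form b x = (\<Sum>i\<in>UNIV. ((J_mat *v (\<chi> k. dderiv f b x \<bullet> e k x)) $ i) *\<^sub>R e i x)"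

definition conn :: "'a \<Rightarrow> 'a \<Rightarrow> 4 \<Rightarrow> 4 \<Rightarrow> real" where
  "conn x a i j = dderiv (e i) a x \<bullet> e j x"

text \<open>This is d\<eta> on the constant coordinate fields \<open>a\<close> and \<open>b\<close>;
  their bracket vanishes, so two terms suffice.\<close>

definition curl :: "'a \<Rightarrow> 'a \<Rightarrow> 'a \<Rightarrow> 'v" where
  "curl a b x = dderiv (J_form b) a x - dderiv (J_form a) b x"

lemmas diff_e = smooth_on_differentiable[OF e]

lemma smooth_J_form: "smooth_on S (J_form b)"
proof -
  have X: "smooth_on S (\<lambda>x. dderiv f b x \<bullet> e k x)" for k
    by (intro smooth_on_inner smooth_on_dderiv S f e)
  have "smooth_on S (\<lambda>x. ((J_mat *v (\<chi> k. dderiv f b x \<bullet> e k x)) $ i))" for i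
    using exhaust_4[of i] X smooth_on_minus[OF S X] by auto
  then show ?thesis
    unfolding J_form_def by (intro smooth_on_sum smooth_on_scaleR S e)
qed

lemma smooth_curl: "smooth_on S (curl a b)"
  unfolding curl_def by (intro smooth_on_diff smooth_on_dderiv smooth_J_form S)

lemmas diff_J_form = smooth_on_differentiable[OF smooth_J_form]

lemma inner_frame_sum:
  assumes "x \<in> S" shows "(\<Sum>i\<in>UNIV. c i *\<^sub>R e i x) \<bullet> e j x = c j"
  by (simp add: inner_sum_left orthonormal[OF assms] if_distrib[of "\<lambda>y. _ * y"] cong: if_cong)

lemma tangent_expansion:
  assumes "x \<in> S" "w \<in> span (range (\<lambda>i. e i x))"
  shows "w = (\<Sum>i\<in>UNIV. (w \<bullet> e i x) *\<^sub>R e i x)"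
  by (rule orthonormal_expansion[OF orthonormal[OF assms(1)] assms(2)])

lemma frame_vectors:
  assumes "x \<in> S" obtains A where "\<And>i. dderiv f (A i) x = e i x"
proof -
  have "\<exists>a. dderiv f a x = e i x" for i
    using tangent[OF assms] span_base[of "e i x" "range (\<lambda>i. e i x)"] by (metis rangeE rangeI)
  then show ?thesis using that by metis
qed

lemma coordinates_expansion:
  assumes x: "x \<in> S" and A: "\<And>i. dderiv f (A i) x = e i x"
  shows "a = (\<Sum>k\<in>UNIV. (dderiv f a x \<bullet> e k x) *\<^sub>R A k)"
proof (rule injD[OF inj[OF x]])
  have lin: "linear (\<lambda>a. dderiv f a x)"
    using dderiv_linear[OF smooth_on_differentiable[OF f x]] .
  have "dderiv f (\<Sum>k\<in>UNIV. (dderiv f a x \<bullet> e k x) *\<^sub>R A k) x = (\<Sum>k\<in>UNIV. (dderiv f a x \<bullet> e k x) *\<^sub>R e k x)"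
    by (simp only: linear_sum[OF lin] linear_cmul[OF lin] A)
  also have "\<dots> = dderiv f a x"
    using tangent_expansion[OF x, of "dderiv f a x"] tangent[OF x] by auto
  finally show "dderiv f a x = dderiv f (\<Sum>k\<in>UNIV. (dderiv f a x \<bullet> e k x) *\<^sub>R A k) x" by simp
qed

text \<open>Tensoriality of II: in the derivative of the frame expansion of Z, the terms that
  differentiate the coefficients are tangent and are killed by \<nu>.\<close>

lemma normal_dderiv_tangent_field:
  assumes U: "open U" "x \<in> U" "U \<subseteq> S" and Z: "Z differentiable (at x)"
    and tan: "\<And>y. y \<in> U \<Longrightarrow> Z y \<in> span (range (\<lambda>i. e i y))"
    and \<nu>: "\<And>i. \<nu> \<bullet> e i x = 0"
  shows "\<nu> \<bullet> dderiv Z a x = (\<Sum>i\<in>UNIV. (Z x \<bullet> e i x) * (\<nu> \<bullet> dderiv (e i) a x))"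
proof -
  have x: "x \<in> S" using U by auto
  have d: "(\<lambda>y. Z y \<bullet> e i y) differentiable (at x)" for i
    by (rule differentiableI, rule bounded_bilinear.FDERIV[OF bounded_bilinear_inner];
        rule has_derivative_dderiv; fact Z diff_e[OF x])
  have d': "(\<lambda>y. (Z y \<bullet> e i y) *\<^sub>R e i y) differentiable (at x)" for i
    by (rule differentiableI, rule bounded_bilinear.FDERIV[OF bounded_bilinear_scaleR];
        rule has_derivative_dderiv; fact d diff_e[OF x])
  have "dderiv Z a x = dderiv (\<lambda>y. \<Sum>i\<in>UNIV. (Z y \<bullet> e i y) *\<^sub>R e i y) a x"
    by (rule dderiv_cong_open[OF U(1,2)], rule tangent_expansion) (use U tan in auto)
  also have "\<dots> = (\<Sum>i\<in>UNIV. (Z x \<bullet> e i x) *\<^sub>R dderiv (e i) a x + dderiv (\<lambda>y. Z y \<bullet> e i y) a x *\<^sub>R e i x)"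
    by (simp add: dderiv_sum d' dderiv_scaleR d diff_e[OF x])
  finally show ?thesis
    by (simp add: inner_sum_right inner_add_right \<nu>)
qed

lemma J_form_tangent: "J_form b x \<in> span (range (\<lambda>i. e i x))"
  unfolding J_form_def by (intro span_sum span_scale span_base) auto

text \<open>The right side is S(X_a, J X_b), with X_a, X_b the frame coordinates of the images of
  \<open>a\<close>, \<open>b\<close> and S the matrix of \<nu> paired with II.\<close>

lemma normal_dderiv_J_form:
  assumes x: "x \<in> S" and \<nu>: "\<And>i. \<nu> \<bullet> e i x = 0" and A: "\<And>i. dderiv f (A i) x = e i x"
  shows "\<nu> \<bullet> dderiv (J_form b) a x = (\<Sum>i\<in>UNIV. \<Sum>k\<in>UNIV.
     (J_mat *v (\<chi> k. dderiv f b x \<bullet> e k x)) $ i * ((\<chi> k. dderiv f a x \<bullet> e k x) $ k)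
      * (\<chi> i j. \<nu> \<bullet> dderiv (e j) (A i) x) $ k $ i)"
proof -
  have "dderiv (e i) a x = (\<Sum>k\<in>UNIV. (dderiv f a x \<bullet> e k x) *\<^sub>R dderiv (e i) (A k) x)" for i
  proof -
    note lin = dderiv_linear[OF diff_e[OF x]]
    have "dderiv (e i) a x = dderiv (e i) (\<Sum>k\<in>UNIV. (dderiv f a x \<bullet> e k x) *\<^sub>R A k) x"
      using coordinates_expansion[OF x A] by simp
    then show ?thesis by (simp only: linear_sum[OF lin] linear_cmul[OF lin])
  qed
  then have *: "\<nu> \<bullet> dderiv (e i) a x = (\<Sum>k\<in>UNIV. (dderiv f a x \<bullet> e k x) * (\<nu> \<bullet> dderiv (e i) (A k) x))" for i
    by (simp add: inner_sum_right)
  have "\<nu> \<bullet> dderiv (J_form b) a x = (\<Sum>i\<in>UNIV. (J_form b x \<bullet> e i x) * (\<nu> \<bullet> dderiv (e i) a x))"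
    by (rule normal_dderiv_tangent_field[OF S x order_refl diff_J_form[OF x] J_form_tangent \<nu>])
  moreover have "J_form b x \<bullet> e i x = (J_mat *v (\<chi> k. dderiv f b x \<bullet> e k x)) $ i" for i
    unfolding J_form_def by (rule inner_frame_sum[OF x])
  ultimately show ?thesis
    by (simp add: * sum_distrib_left mult.assoc)
qed

lemma conn_skew:
  assumes x: "x \<in> S" shows "conn x a i j = - conn x a j i"
proof -
  have "dderiv (\<lambda>y. e i y \<bullet> e j y) a x = dderiv (\<lambda>y. if i = j then 1 else 0::real) a x"
    by (rule dderiv_cong_open[OF S x]) (simp add: orthonormal)
  also have "\<dots> = 0" by simp
  finally show ?thesis
    using dderiv_inner[OF diff_e[OF x] diff_e[OF x], of i j a] by (simp add: conn_def inner_commute)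
qed

definition tau :: "'a \<Rightarrow> 'a \<Rightarrow> real" where "tau x a = conn x a 3 2 - conn x a 4 1"
definition ups :: "'a \<Rightarrow> 'a \<Rightarrow> real" where "ups x a = - (conn x a 2 1 + conn x a 3 4)"

text \<open>The second summand is the component of \<open>(\<nabla>\<^sub>a J) \<partial>\<^sub>b f\<close>; an endomorphism that is skew
  and anticommutes with \<open>J\<close> is a combination of \<open>T\<close> and \<open>U\<close>.\<close>

lemma tangential_dderiv_J_form:
  assumes x: "x \<in> S"
  shows "dderiv (J_form b) a x \<bullet> e j x = (J_mat *v (\<chi> k. dderiv (dderiv f b) a x \<bullet> e k x)) $ j
     + (\<Sum>l\<in>UNIV. (dderiv f b x \<bullet> e l x) * (tau x a * T_mat $ j $ l + ups x a * U_mat $ j $ l))"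
proof -
  define X where "X k y = dderiv f b y \<bullet> e k y" for k y
  have diff_fb: "dderiv f b differentiable (at x)"
    by (rule smooth_on_differentiable[OF smooth_on_dderiv[OF f] x])
  have diff_X: "X k differentiable (at x)" for k
    unfolding X_def by (rule smooth_on_differentiable[OF _ x]) (intro smooth_on_inner smooth_on_dderiv S f e)
  have fb: "dderiv f b x = (\<Sum>l\<in>UNIV. X l x *\<^sub>R e l x)"
    using tangent_expansion[OF x, of "dderiv f b x"] tangent[OF x] by (auto simp: X_def)
  have dX: "dderiv (X k) a x = dderiv (dderiv f b) a x \<bullet> e k x + (\<Sum>l\<in>UNIV. X l x * conn x a k l)" for k
  proof -
    have "dderiv (X k) a x = dderiv f b x \<bullet> dderiv (e k) a x + dderiv (dderiv f b) a x \<bullet> e k x"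
      unfolding X_def by (rule dderiv_inner[OF diff_fb diff_e[OF x]])
    also have "dderiv f b x \<bullet> dderiv (e k) a x = (\<Sum>l\<in>UNIV. X l x * conn x a k l)"
      by (simp add: fb inner_sum_left conn_def inner_commute[of "e _ x"])
    finally show ?thesis by simp
  qed
  define Y where "Y i y = (J_mat *v (\<chi> k. X k y)) $ i" for i y
  have Y: "Y 1 = (\<lambda>y. - X 3 y)" "Y 2 = (\<lambda>y. - X 4 y)" "Y 3 = X 1" "Y 4 = X 2"
    by (simp_all add: Y_def fun_eq_iff)
  have diff_Y: "Y i differentiable (at x)" for i
    using exhaust_4[of i] Y diff_X by (auto intro: differentiable_minus)
  have dY_minus: "dderiv (\<lambda>y. - X k y) a x = - dderiv (X k) a x" for k
    by (rule dderiv_eqI, rule has_derivative_minus, rule has_derivative_dderiv[OF diff_X])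
  have dY: "dderiv (Y i) a x = (J_mat *v (\<chi> k. dderiv (X k) a x)) $ i" for i
    using exhaust_4[of i] Y dY_minus by auto
  have d': "(\<lambda>y. Y i y *\<^sub>R e i y) differentiable (at x)" for i
    by (rule differentiableI, rule bounded_bilinear.FDERIV[OF bounded_bilinear_scaleR];
        rule has_derivative_dderiv; fact diff_Y diff_e[OF x])
  have "dderiv (J_form b) a x = dderiv (\<lambda>y. \<Sum>i\<in>UNIV. Y i y *\<^sub>R e i y) a x"
    by (simp add: J_form_def[abs_def] Y_def X_def)
  also have "\<dots> = (\<Sum>i\<in>UNIV. dderiv (Y i) a x *\<^sub>R e i x) + (\<Sum>i\<in>UNIV. Y i x *\<^sub>R dderiv (e i) a x)"
    by (simp add: dderiv_sum d' dderiv_scaleR diff_Y diff_e[OF x] sum.distrib)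
  finally have "dderiv (J_form b) a x \<bullet> e j x = dderiv (Y j) a x + (\<Sum>i\<in>UNIV. Y i x * conn x a i j)"
    by (simp only: inner_add_left inner_frame_sum[OF x]) (simp add: inner_sum_left conn_def)
  \<comment> \<open>Skewness leaves six connection coefficients. Their part commuting with J is
    four-dimensional and cancels; the remaining two combinations are \<open>tau\<close> and
    \<open>ups\<close>.\<close>
  moreover have "conn x a i i = 0" for i using conn_skew[OF x, of a i i] by simp
  moreover have "conn x a 2 1 = - conn x a 1 2" "conn x a 3 1 = - conn x a 1 3" "conn x a 4 1 = - conn x a 1 4"
     "conn x a 3 2 = - conn x a 2 3" "conn x a 4 2 = - conn x a 2 4" "conn x a 4 3 = - conn x a 3 4"
    by (rule conn_skew[OF x])+
  ultimately show ?thesis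
    unfolding X_def[symmetric] dY using exhaust_4[of j]
    by (auto simp: dX sum_4 Y tau_def ups_def algebra_simps)
qed

text \<open>The first summand of \<open>tangential_dderiv_J_form\<close> is J applied to the second
  derivative of \<open>f\<close>, symmetric in \<open>a\<close> and \<open>b\<close>, hence it drops
  out on antisymmetrising.\<close>

lemma curl_inner:
  assumes x: "x \<in> S"
  shows "curl a b x \<bullet> e j x =
     (\<Sum>l\<in>UNIV. (dderiv f b x \<bullet> e l x) * (tau x a * T_mat $ j $ l + ups x a * U_mat $ j $ l))
   - (\<Sum>l\<in>UNIV. (dderiv f a x \<bullet> e l x) * (tau x b * T_mat $ j $ l + ups x b * U_mat $ j $ l))"
  unfolding curl_def inner_diff_left tangential_dderiv_J_form[OF x] dderiv_commute[OF S f x, of b a]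
  by simp

text \<open>The test vector \<nu> is the normal part of the curl itself. Pairing with it gives
  S(X_a, J X_b) - S(X_b, J X_a), zero by \<open>Q_A_J_symmetric\<close>, so \<nu> is orthogonal to
  itself.\<close>

lemma curl_tangent:
  assumes x: "x \<in> S" and Q: "forms x \<subseteq> Q_A"
  shows "curl a b x \<in> span (range (\<lambda>i. e i x))"
proof -
  obtain A where A: "\<And>i. dderiv f (A i) x = e i x" using frame_vectors[OF x] by blast
  define \<nu> where "\<nu> = curl a b x - (\<Sum>i\<in>UNIV. (curl a b x \<bullet> e i x) *\<^sub>R e i x)"
  have \<nu>: "\<nu> \<bullet> e i x = 0" for i
    by (simp add: \<nu>_def inner_diff_left inner_frame_sum[OF x])
  have "(\<chi> i j. \<nu> \<bullet> dderiv (e j) (A i) x) \<in> forms x"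
    using \<nu> A unfolding forms_def by blast
  then have "(\<chi> i j. \<nu> \<bullet> dderiv (e j) (A i) x) \<in> Q_A" using Q by blast
  then have "\<nu> \<bullet> curl a b x = 0"
    unfolding curl_def inner_diff_right normal_dderiv_J_form[OF x \<nu> A] right_minus_eq
    by (rule Q_A_J_symmetric)
  then have "\<nu> \<bullet> \<nu> = 0"
    unfolding \<nu>_def[THEN arg_cong[where f = "inner \<nu>"]] by (simp add: inner_diff_right inner_sum_right \<nu>)
  then have "curl a b x = (\<Sum>i\<in>UNIV. (curl a b x \<bullet> e i x) *\<^sub>R e i x)" by (simp add: \<nu>_def)
  then show ?thesis by (metis (no_types, lifting) rangeI span_base span_scale span_sum)
qed

lemma cyclic_dderiv_curl:
  assumes x: "x \<in> S"
  shows "dderiv (curl a b) c x + dderiv (curl b c) a x + dderiv (curl c a) b x = 0"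
proof -
  have *: "dderiv (curl a b) c x = dderiv (dderiv (J_form b) a) c x - dderiv (dderiv (J_form a) b) c x" for a b c
    unfolding curl_def
    by (rule dderiv_diff; rule smooth_on_differentiable[OF smooth_on_dderiv[OF smooth_J_form] x])
  note comm = dderiv_commute[OF S smooth_J_form x]
  show ?thesis
    unfolding * comm[of b a c] comm[of a c b] comm[of c b a] by simp
qed

text \<open>The inclusion in \<open>Q_A\<close> is assumed on all of \<open>S\<close>, so that the
  curl is a tangent field that can be differentiated; the nullspace condition is assumed at
  \<open>x\<close> alone.\<close>

theorem curl_eq_0:
  assumes Q: "\<And>y. y \<in> S \<Longrightarrow> forms y \<subseteq> Q_A" and x: "x \<in> S"
    and null: "common_nullspace (K_map ` forms x) = {0}"
  shows "curl a b x = 0"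
proof -
  obtain A where A: "\<And>i. dderiv f (A i) x = e i x" using frame_vectors[OF x] by blast
  \<comment> \<open>The sign in the second block makes \<open>K_map M *v ?w\<close> equal to [M,T]
    \<upsilon> - [M,U] \<tau>.\<close>
  let ?w = "(\<chi> j. case j of Inl k \<Rightarrow> ups x (A k) | Inr k \<Rightarrow> - tau x (A k)) :: real^(4 + 4)"
  have "?w \<in> common_nullspace (K_map ` forms x)"
    unfolding common_nullspace_def
  proof clarify
    fix M assume M: "M \<in> forms x"
    then obtain \<nu> A' where \<nu>: "\<And>i. \<nu> \<bullet> e i x = 0" and A': "\<And>i. dderiv f (A' i) x = e i x"
      and M_eq: "M = (\<chi> i j. \<nu> \<bullet> dderiv (e j) (A' i) x)" unfolding forms_def by blast
    have "A' i = A i" for i using injD[OF inj[OF x], of "A' i" "A i"] A A' by simp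
    then have M_nth: "M $ i $ j = \<nu> \<bullet> dderiv (e j) (A i) x" for i j by (simp add: M_eq)
    have N: "curl (A i) (A j) x \<bullet> e l x = (tau x (A i) * T_mat $ l $ j + ups x (A i) * U_mat $ l $ j)
        - (tau x (A j) * T_mat $ l $ i + ups x (A j) * U_mat $ l $ i)" for i j l
      unfolding curl_inner[OF x] A
      by (simp add: orthonormal[OF x] if_distrib[of "\<lambda>y. y * _"] cong: if_cong)
    \<comment> \<open>The directions \<open>A i\<close>, \<open>A j\<close> are frozen at their
      values for \<open>x\<close>, so the derivative falls on the curl alone and its normal part is
      II(e_k, curl).\<close>
    have D: "\<nu> \<bullet> dderiv (curl (A i) (A j)) (A k) x = (\<Sum>l\<in>UNIV. M $ k $ l * (curl (A i) (A j) x \<bullet> e l x))" for i j k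
      unfolding M_nth
      by (subst normal_dderiv_tangent_field[OF S x order_refl smooth_on_differentiable[OF smooth_curl x] curl_tangent[OF _ Q] \<nu>])
        (auto simp: mult.commute)
    show "K_map M *v ?w = 0"
    proof (rule K_map_null_of_cyclic)
      show "M \<in> Q_A" using M Q[OF x] by blast
      show "(\<Sum>l\<in>UNIV. M $ k $ l * ((tau x (A i) * T_mat $ l $ j + ups x (A i) * U_mat $ l $ j)
             - (tau x (A j) * T_mat $ l $ i + ups x (A j) * U_mat $ l $ i)))
        + (\<Sum>l\<in>UNIV. M $ i $ l * ((tau x (A j) * T_mat $ l $ k + ups x (A j) * U_mat $ l $ k)
             - (tau x (A k) * T_mat $ l $ j + ups x (A k) * U_mat $ l $ j)))
        + (\<Sum>l\<in>UNIV. M $ j $ l * ((tau x (A k) * T_mat $ l $ i + ups x (A k) * U_mat $ l $ i)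
             - (tau x (A i) * T_mat $ l $ k + ups x (A i) * U_mat $ l $ k))) = 0" for i j k
        using arg_cong[OF cyclic_dderiv_curl[OF x, of "A i" "A j" "A k"], of "inner \<nu>"]
        by (simp only: inner_add_right D N inner_zero_right)
    qed
  qed
  then have "?w = 0" using null by blast
  then have w: "?w $ j = 0" for j by simp
  have A0: "ups x (A k) = 0" "tau x (A k) = 0" for k
    using w[of "Inl k"] w[of "Inr k"] by simp_all
  \<comment> \<open>So far \<tau> and \<upsilon> vanish on frame vectors; linearity extends this to
    every direction.\<close>
  have conn_lin: "conn x a i j = (\<Sum>k\<in>UNIV. (dderiv f a x \<bullet> e k x) * conn x (A k) i j)" for a i j
  proof -
    note lin = dderiv_linear[OF diff_e[OF x]]
    have "dderiv (e i) a x = dderiv (e i) (\<Sum>k\<in>UNIV. (dderiv f a x \<bullet> e k x) *\<^sub>R A k) x"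
      using coordinates_expansion[OF x A] by simp
    then have "dderiv (e i) a x = (\<Sum>k\<in>UNIV. (dderiv f a x \<bullet> e k x) *\<^sub>R dderiv (e i) (A k) x)"
      by (simp only: linear_sum[OF lin] linear_cmul[OF lin])
    then show ?thesis by (simp add: conn_def inner_sum_left)
  qed
  have "tau x a = (\<Sum>k\<in>UNIV. (dderiv f a x \<bullet> e k x) * tau x (A k))" for a
    unfolding tau_def conn_lin[of a] by (simp add: sum_subtractf right_diff_distrib)
  moreover have "ups x a = (\<Sum>k\<in>UNIV. (dderiv f a x \<bullet> e k x) * ups x (A k))" for a
    unfolding ups_def conn_lin[of a] by (simp add: sum_subtractf right_diff_distrib sum_negf)
  ultimately have "tau x a = 0" "ups x a = 0" for a by (simp_all add: A0)
  then have "curl a b x \<bullet> e j x = 0" for j by (simp add: curl_inner[OF x])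
  then show ?thesis
    using tangent_expansion[OF x curl_tangent[OF x Q[OF x]], of a b] by simp
qed

end

subsection \<open>Immersed manifolds\<close>

locale immersed_manifold =
  fixes \<A> :: "('m::topological_space, 'e::euclidean_space) chart set"
    and F :: "'m \<Rightarrow> 'v::euclidean_space"
  assumes atlas: "smooth_atlas \<A>" and immersion: "immersion \<A> F"
begin

lemma ex_chart: obtains c where "c \<in> \<A>" "p \<in> fst c"
  using atlas unfolding smooth_atlas_def by blast

context
  fixes c :: "('m, 'e) chart"
  assumes c: "c \<in> \<A>"
begin

lemma chart_props:
  shows open_chart: "open (fst c)"
    and open_chart_image: "open (snd c ` fst c)"
    and chart_homeomorphism: "homeomorphism (fst c) (snd c ` fst c) (snd c) (param c)"
  using atlas c unfolding smooth_atlas_def by (cases c; force)+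

lemma param_chart: "p \<in> fst c \<Longrightarrow> param c (snd c p) = p"
  using chart_homeomorphism by (simp add: homeomorphism_def)

lemma chart_param: "y \<in> snd c ` fst c \<Longrightarrow> snd c (param c y) = y"
  using chart_homeomorphism by (auto simp: homeomorphism_def)

lemma param_in_chart: "y \<in> snd c ` fst c \<Longrightarrow> param c y \<in> fst c"
  using param_chart by auto

lemma param_in: "y \<in> snd c ` (fst c \<inter> W) \<Longrightarrow> param c y \<in> W"
  using param_chart by auto

lemma open_chart_image_Int:
  assumes "open W" shows "open (snd c ` (fst c \<inter> W))"
proof -
  have "openin (top_of_set (snd c ` fst c)) (snd c ` (fst c \<inter> W))"
    by (rule homeomorphism_imp_open_map[OF chart_homeomorphism]) (use assms in auto)
  then show ?thesis using open_chart_image openin_open_eq by blast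
qed

lemma smooth_on_chart:
  "smooth_map_on \<A> W f \<Longrightarrow> smooth_on (snd c ` (fst c \<inter> W)) (f \<circ> param c)"
  using c unfolding smooth_map_on_def by (cases c) force

lemma smooth_F_chart: "smooth_on (snd c ` fst c) (F \<circ> param c)"
  using smooth_on_chart[of UNIV F] immersion by (simp add: immersion_def)

lemma inj_chart_derivative: "p \<in> fst c \<Longrightarrow> inj (chart_derivative c F p)"
  using immersion c unfolding immersion_def by blast

lemma linear_chart_derivative: "p \<in> fst c \<Longrightarrow> linear (chart_derivative c F p)"
  unfolding chart_derivative_def
  by (rule linear_frechet_derivative, rule smooth_on_differentiable[OF smooth_F_chart]) auto

end

section \<open>Independence of the chart\<close>

lemma chart_change:
  assumes c: "c \<in> \<A>" and c': "c' \<in> \<A>" and p: "p \<in> fst c" "p \<in> fst c'"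
    and f: "(f \<circ> param c has_derivative D) (at (snd c p))"
  shows "(f \<circ> param c' has_derivative (\<lambda>a. D (chart_derivative c' (snd c) p a))) (at (snd c' p))"
proof -
  let ?S = "snd c' ` (fst c' \<inter> fst c)"
  have S: "open ?S" "snd c' p \<in> ?S"
    using open_chart_image_Int[OF c' open_chart[OF c]] p by auto
  have "smooth_on ?S (snd c \<circ> param c')"
    using atlas c c' unfolding smooth_atlas_def by (cases c, cases c') force
  then have "(snd c \<circ> param c') differentiable (at (snd c' p))"
    using smooth_on_differentiable S by blast
  then have \<tau>: "(snd c \<circ> param c' has_derivative chart_derivative c' (snd c) p) (at (snd c' p))"
    unfolding chart_derivative_def by (rule has_derivative_dderiv)
  have "(snd c \<circ> param c') (snd c' p) = snd c p" using param_chart[OF c' p(2)] by simp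
  then have "((f \<circ> param c) \<circ> (snd c \<circ> param c') has_derivative D \<circ> chart_derivative c' (snd c) p) (at (snd c' p))"
    using f by (intro diff_chain_at[OF \<tau>]) simp
  then show ?thesis
    unfolding o_def
    by (rule has_derivative_transform_within_open[OF _ S])
      (use param_chart[OF c'] param_chart[OF c] in auto)
qed

lemma chart_derivative_change:
  assumes "c \<in> \<A>" "c' \<in> \<A>" "p \<in> fst c" "p \<in> fst c'" and f: "(f \<circ> param c) differentiable (at (snd c p))"
  shows "chart_derivative c' f p a = chart_derivative c f p (chart_derivative c' (snd c) p a)"
  unfolding chart_derivative_def[of c' f]
  by (rule dderiv_eqI, rule chart_change[OF assms(1-4)])
    (use has_derivative_dderiv[OF f] in \<open>simp add: chart_derivative_def\<close>)

lemma differentiable_F: "c \<in> \<A> \<Longrightarrow> p \<in> fst c \<Longrightarrow> (F \<circ> param c) differentiable (at (snd c p))"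
  using smooth_on_differentiable[OF smooth_F_chart] by blast

lemma tangent_space_chart:
  assumes "c \<in> \<A>" "p \<in> fst c"
  shows "tangent_space \<A> F p = range (chart_derivative c F p)"
proof -
  have "range (chart_derivative c' F p) \<subseteq> range (chart_derivative c F p)" if "c' \<in> \<A>" "p \<in> fst c'" for c'
    using chart_derivative_change[OF assms(1) that(1) assms(2) that(2) differentiable_F[OF assms]] by auto
  then show ?thesis using assms unfolding tangent_space_def by blast
qed

text \<open>The definite description is single-valued because the differential of F is injective: a
  tangent vector determines its coordinates in each chart, and those are related by the transition
  map.\<close>

lemma dir_deriv_chart:
  assumes c: "c \<in> \<A>" "p \<in> fst c" and f: "(f \<circ> param c) differentiable (at (snd c p))"
  shows "dir_deriv \<A> F f p (chart_derivative c F p a) = chart_derivative c f p a"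
  unfolding dir_deriv_def
proof (rule the_equality)
  show "\<exists>c'\<in>\<A>. p \<in> fst c' \<and> (\<exists>a'. chart_derivative c F p a = chart_derivative c' F p a' \<and>
      chart_derivative c f p a = chart_derivative c' f p a')"
    using c by blast
next
  fix w
  assume "\<exists>c'\<in>\<A>. p \<in> fst c' \<and> (\<exists>a'. chart_derivative c F p a = chart_derivative c' F p a' \<and>
      w = chart_derivative c' f p a')"
  then obtain c' a' where c': "c' \<in> \<A>" "p \<in> fst c'"
    and eq: "chart_derivative c F p a = chart_derivative c' F p a'" "w = chart_derivative c' f p a'" by blast
  note ch = chart_derivative_change[OF c(1) c'(1) c(2) c'(2)]
  have "a = chart_derivative c' (snd c) p a'"
    using eq(1) ch[OF differentiable_F[OF c]] injD[OF inj_chart_derivative[OF c]] by metis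
  then show "w = chart_derivative c f p a" using eq(2) ch[OF f] by simp
qed

lemma subspace_tangent_space: "subspace (tangent_space \<A> F p)"
proof -
  obtain c where "c \<in> \<A>" "p \<in> fst c" using ex_chart .
  then show ?thesis
    using linear_subspace_image[OF linear_chart_derivative subspace_UNIV] tangent_space_chart by metis
qed

text \<open>Orthogonal decomposition gives existence; two candidates for the projection differ by a
  vector both tangent and normal, hence zero.\<close>

lemma inner_normal_proj:
  assumes "\<nu> \<in> normal_space \<A> F p"
  shows "\<nu> \<bullet> normal_proj \<A> F p w = \<nu> \<bullet> w"
proof -
  let ?T = "tangent_space \<A> F p"
  have orth: "n \<bullet> t = 0" if "n \<in> normal_space \<A> F p" "t \<in> ?T" for n t
    using that by (simp add: normal_space_def orthogonal_comp_def orthogonal_def inner_commute[of n])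
  obtain t n where w: "t \<in> span ?T" "w = t + n" "\<And>v. v \<in> span ?T \<Longrightarrow> orthogonal n v"
    using orthogonal_subspace_decomp_exists[of ?T w] by blast
  have T: "span ?T = ?T" by (simp add: subspace_tangent_space)
  have n: "n \<in> normal_space \<A> F p \<and> w - n \<in> ?T"
    using w unfolding T by (simp add: normal_space_def orthogonal_comp_def orthogonal_commute)
  have "normal_proj \<A> F p w = n"
    unfolding normal_proj_def
  proof (rule the_equality)
    show "n \<in> normal_space \<A> F p \<and> w - n \<in> ?T" by (rule n)
    fix n' assume n': "n' \<in> normal_space \<A> F p \<and> w - n' \<in> ?T"
    then have "n' - n \<in> ?T" using subspace_diff[OF subspace_tangent_space, of "w - n" p "w - n'"] n by simp
    then have "(n' - n) \<bullet> (n' - n) = 0" using orth n n' by (simp add: inner_diff_left)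
    then show "n' = n" by simp
  qed
  then show ?thesis using w orth[OF assms, of t] unfolding T by (simp add: inner_add_right)
qed

end

section \<open>Matching frames in a chart with the invariant second fundamental form\<close>

locale framed_chart = immersed_manifold \<A> F
  for \<A> :: "('m::topological_space, real^4) chart set" and F :: "'m \<Rightarrow> 'v::euclidean_space" +
  fixes W :: "'m set" and e :: "4 \<Rightarrow> 'm \<Rightarrow> 'v" and c :: "('m, real^4) chart"
  assumes frame: "adapted_frame \<A> F W e" and c: "c \<in> \<A>"
begin

abbreviation "S \<equiv> snd c ` (fst c \<inter> W)"

lemma open_W: "open W" using frame by (simp add: adapted_frame_def)

lemma frame_basis: "p \<in> W \<Longrightarrow> orthonormal_basis (tangent_space \<A> F p) (\<lambda>i. e i p)"
  using frame by (simp add: adapted_frame_def)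

lemma smooth_frame: "smooth_map_on \<A> W (e i)"
  using frame by (simp add: adapted_frame_def vector_field_on_def)

lemma span_frame: "p \<in> W \<Longrightarrow> span (range (\<lambda>i. e i p)) = tangent_space \<A> F p"
  using frame_basis by (simp add: orthonormal_basis_def)

sublocale adapted_coordinates S "F \<circ> param c" "\<lambda>i. e i \<circ> param c"
proof
  show "open S" by (rule open_chart_image_Int[OF c open_W])
  show "smooth_on S (F \<circ> param c)"
    by (rule smooth_on_subset[OF smooth_F_chart[OF c]]) auto
  show "smooth_on S (e i \<circ> param c)" for i
    by (rule smooth_on_chart[OF c smooth_frame])
  fix x assume x: "x \<in> S"
  then have p: "param c x \<in> fst c" "param c x \<in> W" and cp: "snd c (param c x) = x"
    using param_chart[OF c] by auto
  show "(e i \<circ> param c) x \<bullet> (e j \<circ> param c) x = (if i = j then 1 else 0)" for i j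
    using frame_basis[OF p(2)] by (simp add: orthonormal_basis_def)
  show "span (range (\<lambda>i. (e i \<circ> param c) x)) = range (\<lambda>a. dderiv (F \<circ> param c) a x)"
    using span_frame[OF p(2)] tangent_space_chart[OF c p(1)] by (simp add: chart_derivative_def cp)
  show "inj (\<lambda>a. dderiv (F \<circ> param c) a x)"
    using inj_chart_derivative[OF c p(1)] by (simp add: chart_derivative_def cp)
qed

lemma normal_space_iff:
  assumes p: "p \<in> W"
  shows "\<nu> \<in> normal_space \<A> F p \<longleftrightarrow> (\<forall>i. \<nu> \<bullet> e i p = 0)"
proof
  assume "\<nu> \<in> normal_space \<A> F p"
  then show "\<forall>i. \<nu> \<bullet> e i p = 0"
    unfolding normal_space_def span_frame[OF p, symmetric]
    by (auto simp: orthogonal_comp_def orthogonal_def inner_commute[of \<nu>] intro: span_base)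
next
  assume "\<forall>i. \<nu> \<bullet> e i p = 0"
  then have "orthogonal \<nu> y" if "y \<in> range (\<lambda>i. e i p)" for y
    using that by (auto simp: orthogonal_def)
  then have "orthogonal \<nu> t" if "t \<in> span (range (\<lambda>i. e i p))" for t
    using orthogonal_to_span[OF that] by blast
  then show "\<nu> \<in> normal_space \<A> F p"
    unfolding normal_space_def span_frame[OF p, symmetric]
    by (simp add: orthogonal_comp_def orthogonal_commute)
qed

text \<open>\<open>second_ff\<close> differentiates an unspecified extension. The frame field
  \<open>e j\<close> shows that one exists, and \<open>normal_dderiv_tangent_field\<close> shows
  that only its value at the point matters.\<close>

lemma second_ff_frame:
  assumes x: "x \<in> S" and \<nu>: "\<nu> \<in> normal_space \<A> F (param c x)"
    and a: "u = dderiv (F \<circ> param c) a x"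
  shows "\<nu> \<bullet> second_ff \<A> F (param c x) u (e j (param c x)) = \<nu> \<bullet> dderiv (e j \<circ> param c) a x"
proof -
  let ?p = "param c x"
  have p: "?p \<in> fst c" "?p \<in> W" and cp: "snd c ?p = x"
    using x param_chart[OF c] by auto
  define Y where "Y = (SOME Y. \<exists>W. open W \<and> ?p \<in> W \<and> vector_field_on \<A> F W Y \<and> Y ?p = e j ?p)"
  have "vector_field_on \<A> F W (e j)" using frame by (simp add: adapted_frame_def)
  then have "\<exists>Y W. open W \<and> ?p \<in> W \<and> vector_field_on \<A> F W Y \<and> Y ?p = e j ?p"
    using open_W p by blast
  from someI_ex[OF this, folded Y_def] obtain W'
    where W': "open W'" "?p \<in> W'" "vector_field_on \<A> F W' Y" and Y: "Y ?p = e j ?p" by blast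
  let ?U = "snd c ` (fst c \<inter> (W \<inter> W'))"
  have U: "open ?U" "x \<in> ?U" "?U \<subseteq> S"
    using open_chart_image_Int[OF c open_Int[OF open_W W'(1)]] p W'(2) cp by force+
  have "smooth_on (snd c ` (fst c \<inter> W')) (Y \<circ> param c)"
    using W'(3) by (intro smooth_on_chart c) (simp add: vector_field_on_def)
  moreover have "x \<in> snd c ` (fst c \<inter> W')" using U(2) by blast
  ultimately have diff: "(Y \<circ> param c) differentiable (at x)"
    by (rule smooth_on_differentiable)
  have "second_ff \<A> F ?p u (e j ?p) = normal_proj \<A> F ?p (dir_deriv \<A> F Y ?p u)"
    unfolding second_ff_def Y_def Let_def ..
  also have "dir_deriv \<A> F Y ?p u = dderiv (Y \<circ> param c) a x"
    using dir_deriv_chart[OF c p(1), of Y a] diff by (simp add: chart_derivative_def cp a)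
  finally have "\<nu> \<bullet> second_ff \<A> F ?p u (e j ?p) = \<nu> \<bullet> dderiv (Y \<circ> param c) a x"
    using inner_normal_proj[OF \<nu>] by simp
  also have "\<dots> = (\<Sum>i\<in>UNIV. ((Y \<circ> param c) x \<bullet> (e i \<circ> param c) x) * (\<nu> \<bullet> dderiv (e i \<circ> param c) a x))"
  proof (rule normal_dderiv_tangent_field[OF U diff])
    show "(Y \<circ> param c) y \<in> span (range (\<lambda>i. (e i \<circ> param c) y))" if "y \<in> ?U" for y
      using W'(3) param_in[OF c that] by (simp add: vector_field_on_def span_frame)
    show "\<nu> \<bullet> (e i \<circ> param c) x = 0" for i using \<nu> normal_space_iff[OF p(2)] by simp
  qed
  also have "\<dots> = \<nu> \<bullet> dderiv (e j \<circ> param c) a x"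
    using orthonormal[OF x, of j] by (simp add: Y if_distrib[of "\<lambda>y. y * _"] cong: if_cong)
  finally show ?thesis .
qed

lemma forms_eq: assumes x: "x \<in> S" shows "forms x = Q_space \<A> F e (param c x)"
proof -
  let ?p = "param c x"
  have p: "?p \<in> W" using x param_chart[OF c] by auto
  have eq: "form_matrix (\<lambda>i. e i ?p) (\<lambda>u v. \<nu> \<bullet> second_ff \<A> F ?p u v)
      = (\<chi> i j. \<nu> \<bullet> dderiv (e j \<circ> param c) (A i) x)"
    if "\<nu> \<in> normal_space \<A> F ?p" "\<And>i. dderiv (F \<circ> param c) (A i) x = e i ?p" for \<nu> A
    using second_ff_frame[OF x that(1) that(2)[symmetric]] by (simp add: form_matrix_def)
  obtain A where A: "\<And>i. dderiv (F \<circ> param c) (A i) x = (e i \<circ> param c) x"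
    using frame_vectors[OF x] by blast
  show ?thesis
  proof (intro equalityI subsetI)
    fix M assume "M \<in> forms x"
    then obtain \<nu> A where \<nu>: "\<nu> \<in> normal_space \<A> F ?p" and A: "\<And>i. dderiv (F \<circ> param c) (A i) x = e i ?p"
      and "M = (\<chi> i j. \<nu> \<bullet> dderiv (e j \<circ> param c) (A i) x)"
      unfolding forms_def normal_space_iff[OF p] by auto
    then have "M = form_matrix (\<lambda>i. e i ?p) (\<lambda>u v. \<nu> \<bullet> second_ff \<A> F ?p u v)"
      using eq[OF \<nu> A] by simp
    then show "M \<in> Q_space \<A> F e ?p"
      unfolding Q_space_def second_ff_forms_def using \<nu> by (auto intro!: imageI)
  next
    fix M assume "M \<in> Q_space \<A> F e ?p"
    then obtain \<nu> where \<nu>: "\<nu> \<in> normal_space \<A> F ?p"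
      and "M = form_matrix (\<lambda>i. e i ?p) (\<lambda>u v. \<nu> \<bullet> second_ff \<A> F ?p u v)"
      unfolding Q_space_def second_ff_forms_def by blast
    then have "M = (\<chi> i j. \<nu> \<bullet> dderiv (e j \<circ> param c) (A i) x)" using eq[OF \<nu>] A by simp
    moreover have "\<forall>i. \<nu> \<bullet> (e i \<circ> param c) x = 0" using \<nu> normal_space_iff[OF p] by simp
    ultimately show "M \<in> forms x" unfolding forms_def using A by blast
  qed
qed

lemma curl_eq_0_of_null:
  assumes x: "x \<in> S" and "common_nullspace (K_map ` Q_space \<A> F e (param c x)) = {0}"
  shows "curl a b x = 0"
proof (rule curl_eq_0[OF _ x])
  show "forms y \<subseteq> Q_A" if "y \<in> S" for y
    using forms_eq[OF that] frame param_in[OF c that] by (simp add: adapted_frame_def)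
qed (use assms in \<open>simp add: forms_eq\<close>)

end

subsection \<open>The closed 1-form \<open>J dF\<close> and the Kaehler form\<close>

lemma J_mat_mult_self: "J_mat *v (J_mat *v x) = - x"
  by (simp add: vec_eq_iff forall_4)

text \<open>Each point carries its own frame and satisfies the nullspace condition in that frame
  only; a single \<open>\<J>\<close>, represented by \<open>J_mat\<close> in every frame, ties the
  frames together on overlaps.\<close>

locale type_A_immersion = immersed_manifold \<A> F
  for \<A> :: "('m::topological_space, real^4) chart set" and F :: "'m \<Rightarrow> 'v::euclidean_space" +
  fixes \<J> :: "'m \<Rightarrow> 'v \<Rightarrow> 'v" and W :: "'m \<Rightarrow> 'm set" and e :: "'m \<Rightarrow> 4 \<Rightarrow> 'm \<Rightarrow> 'v"
  assumes mem_W: "\<And>p. p \<in> W p"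
    and frames: "\<And>p. adapted_frame \<A> F (W p) (e p)"
    and J_rep: "\<And>p. represented_by \<J> (W p) (e p) J_mat"
    and null: "\<And>p. common_nullspace (K_map ` Q_space \<A> F (e p) p) = {0}"
begin

lemma framed_chart: "c \<in> \<A> \<Longrightarrow> framed_chart \<A> F (W p) (e p) c"
  using frames by unfold_locales

lemma open_W: "open (W p)" using frames[of p] by (simp add: adapted_frame_def)

lemma frame_inner: "q \<in> W p \<Longrightarrow> e p i q \<bullet> e p j q = (if i = j then 1 else 0)"
  using frames[of p] by (simp add: adapted_frame_def orthonormal_basis_def)

lemma tangent_span: "q \<in> W p \<Longrightarrow> tangent_space \<A> F q = span (range (\<lambda>i. e p i q))"
  using frames[of p] by (simp add: adapted_frame_def orthonormal_basis_def)

lemma tangent_expansion: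
  assumes "q \<in> W p" "u \<in> tangent_space \<A> F q"
  shows "u = (\<Sum>i\<in>UNIV. (u \<bullet> e p i q) *\<^sub>R e p i q)"
  by (rule orthonormal_expansion) (use assms frame_inner tangent_span in auto)

lemma J_eq:
  assumes q: "q \<in> W p" "u \<in> tangent_space \<A> F q"
  shows "\<J> q u = (\<Sum>i\<in>UNIV. ((J_mat *v (\<chi> k. u \<bullet> e p k q)) $ i) *\<^sub>R e p i q)"
proof -
  have "\<J> q (\<Sum>i\<in>UNIV. ((\<chi> k. u \<bullet> e p k q) $ i) *\<^sub>R e p i q)
      = (\<Sum>i\<in>UNIV. ((J_mat *v (\<chi> k. u \<bullet> e p k q)) $ i) *\<^sub>R e p i q)"
    using J_rep[of p] q(1) unfolding represented_by_def by blast
  then show ?thesis using tangent_expansion[OF q] by simp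
qed

lemma J_tangent: assumes "u \<in> tangent_space \<A> F q" shows "\<J> q u \<in> tangent_space \<A> F q"
  unfolding J_eq[OF mem_W assms] tangent_span[OF mem_W[of q]]
  by (intro span_sum span_scale span_base) auto

lemma J_inner_frame:
  assumes "q \<in> W p" "u \<in> tangent_space \<A> F q"
  shows "\<J> q u \<bullet> e p j q = (J_mat *v (\<chi> k. u \<bullet> e p k q)) $ j"
  by (simp add: J_eq[OF assms] inner_sum_left frame_inner[OF assms(1)] if_distrib[of "\<lambda>y. _ * y"] cong: if_cong)

lemma tangent_eqI:
  assumes "u \<in> tangent_space \<A> F q" "v \<in> tangent_space \<A> F q" "\<And>i. u \<bullet> e q i q = v \<bullet> e q i q"
  shows "u = v"
  using tangent_expansion[OF mem_W assms(1)] tangent_expansion[OF mem_W assms(2)] assms(3) by simp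

lemma J_J:
  assumes u: "u \<in> tangent_space \<A> F q" shows "\<J> q (\<J> q u) = - u"
proof (rule tangent_eqI)
  note T = J_tangent[OF u]
  show "\<J> q (\<J> q u) \<in> tangent_space \<A> F q" by (rule J_tangent[OF T])
  show "- u \<in> tangent_space \<A> F q" by (rule subspace_neg[OF subspace_tangent_space u])
  show "\<J> q (\<J> q u) \<bullet> e q i q = - u \<bullet> e q i q" for i
    by (simp add: J_inner_frame[OF mem_W T] J_inner_frame[OF mem_W u] J_mat_mult_self)
qed

lemma J_linear:
  assumes u: "u \<in> tangent_space \<A> F q" and v: "v \<in> tangent_space \<A> F q"
  shows "\<J> q (a *\<^sub>R u + b *\<^sub>R v) = a *\<^sub>R \<J> q u + b *\<^sub>R \<J> q v"
proof (rule tangent_eqI)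
  note sub = subspace_add[OF subspace_tangent_space] subspace_scale[OF subspace_tangent_space]
  have w: "a *\<^sub>R u + b *\<^sub>R v \<in> tangent_space \<A> F q" by (intro sub u v)
  show "\<J> q (a *\<^sub>R u + b *\<^sub>R v) \<in> tangent_space \<A> F q" by (rule J_tangent[OF w])
  show "a *\<^sub>R \<J> q u + b *\<^sub>R \<J> q v \<in> tangent_space \<A> F q" by (intro sub J_tangent u v)
  have "(\<chi> k. (a *\<^sub>R u + b *\<^sub>R v) \<bullet> e q k q) = a *\<^sub>R (\<chi> k. u \<bullet> e q k q) + b *\<^sub>R (\<chi> k. v \<bullet> e q k q)"
    by (simp add: vec_eq_iff inner_add_left)
  then show "\<J> q (a *\<^sub>R u + b *\<^sub>R v) \<bullet> e q i q = (a *\<^sub>R \<J> q u + b *\<^sub>R \<J> q v) \<bullet> e q i q" for i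
    by (simp add: J_inner_frame[OF mem_W] w u v inner_add_left matrix_vector_right_distrib
        matrix_vector_mult_scaleR)
qed

lemma inner_tangent:
  assumes u: "u \<in> tangent_space \<A> F q"
  shows "u \<bullet> v = (\<Sum>i\<in>UNIV. (u \<bullet> e q i q) * (v \<bullet> e q i q))"
  by (subst tangent_expansion[OF mem_W u]) (simp add: inner_sum_left inner_commute[of "e q _ q" v])

lemma hermitian: "hermitian \<A> F \<J>"
  unfolding hermitian_def
proof (intro allI ballI)
  fix q u v assume u: "u \<in> tangent_space \<A> F q" and v: "v \<in> tangent_space \<A> F q"
  show "\<J> q u \<bullet> \<J> q v = u \<bullet> v"
    unfolding inner_tangent[OF J_tangent[OF u], of "\<J> q v"] inner_tangent[OF u, of v]
    by (simp add: J_inner_frame[OF mem_W] u v sum_4)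
qed

lemma J_skew:
  assumes u: "u \<in> tangent_space \<A> F q" and v: "v \<in> tangent_space \<A> F q"
  shows "\<J> q u \<bullet> v = - (\<J> q v \<bullet> u)"
  using hermitian J_tangent[OF u] v J_J[OF u] unfolding hermitian_def
  by (metis inner_commute inner_minus_left)

lemma smooth_map_on_J:
  assumes V: "open V" and X: "vector_field_on \<A> F V X"
  shows "smooth_map_on \<A> V (\<lambda>q. \<J> q (X q))"
  unfolding smooth_map_on_def
proof clarify
  fix U \<phi> assume c: "(U, \<phi>) \<in> \<A>"
  let ?c = "(U, \<phi>)"
  show "smooth_on (\<phi> ` (U \<inter> V)) ((\<lambda>q. \<J> q (X q)) \<circ> param ?c)"
  proof (rule smooth_on_local)
    fix x assume "x \<in> \<phi> ` (U \<inter> V)"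
    then obtain p where p: "p \<in> U" "p \<in> V" "x = \<phi> p" by blast
    let ?S = "\<phi> ` (U \<inter> (V \<inter> W p))"
    have S: "open ?S" "x \<in> ?S"
      using open_chart_image_Int[OF c open_Int[OF V open_W[of p]]] p mem_W by auto
    have Xs: "smooth_on ?S (X \<circ> param ?c)"
      using smooth_on_chart[OF c, of V X] X by (auto simp: vector_field_on_def intro: smooth_on_subset)
    have es: "smooth_on ?S (e p i \<circ> param ?c)" for i
      using smooth_on_chart[OF c, of "W p" "e p i"] frames[of p]
      by (auto simp: adapted_frame_def vector_field_on_def intro: smooth_on_subset)
    have comp: "smooth_on ?S (\<lambda>y. X (param ?c y) \<bullet> e p k (param ?c y))" for k
      using smooth_on_inner[OF S(1) Xs es] by (simp add: o_def)
    have "smooth_on ?S (\<lambda>y. (J_mat *v (\<chi> k. X (param ?c y) \<bullet> e p k (param ?c y))) $ i)" for i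
      using exhaust_4[of i] comp smooth_on_minus[OF S(1) comp] by auto
    then have sm: "smooth_on ?S (\<lambda>y. \<Sum>i\<in>UNIV. ((J_mat *v (\<chi> k. X (param ?c y) \<bullet> e p k (param ?c y))) $ i)
        *\<^sub>R (e p i \<circ> param ?c) y)"
      by (intro smooth_on_sum smooth_on_scaleR S es)
    have "((\<lambda>q. \<J> q (X q)) \<circ> param ?c) y
        = (\<Sum>i\<in>UNIV. ((J_mat *v (\<chi> k. X (param ?c y) \<bullet> e p k (param ?c y))) $ i) *\<^sub>R (e p i \<circ> param ?c) y)"
      if "y \<in> ?S" for y
    proof -
      have "param ?c y \<in> V \<inter> W p" using param_in[OF c, of y "V \<inter> W p"] that by simp
      then show ?thesis using X J_eq[of "param ?c y" p] by (simp add: vector_field_on_def)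
    qed
    from smooth_on_cong[OF S(1) this, THEN iffD2, OF _ sm]
    have "smooth_on ?S ((\<lambda>q. \<J> q (X q)) \<circ> param ?c)" .
    then show "\<exists>S. open S \<and> x \<in> S \<and> smooth_on S ((\<lambda>q. \<J> q (X q)) \<circ> param ?c)"
      using S by blast
  qed
qed

lemma almost_complex: "almost_complex \<A> F \<J>"
  unfolding almost_complex_def
  using J_tangent J_J J_linear smooth_map_on_J by (simp add: vector_field_on_def)

section \<open>The 1-form J dF in a chart and its closedness\<close>

definition JdF :: "('m, real^4) chart \<Rightarrow> real^4 \<Rightarrow> real^4 \<Rightarrow> 'v" where
  "JdF c b y = \<J> (param c y) (dderiv (F \<circ> param c) b y)"

context
  fixes c assumes c: "c \<in> \<A>"
begin

lemma dderiv_F_tangent: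
  assumes "y \<in> snd c ` fst c"
  shows "dderiv (F \<circ> param c) b y \<in> tangent_space \<A> F (param c y)"
  using tangent_space_chart[OF c param_in_chart[OF c assms]] chart_param[OF c assms]
  by (simp add: chart_derivative_def)

lemma JdF_eq_J_form:
  assumes "y \<in> snd c ` (fst c \<inter> W p)"
  shows "JdF c b y = adapted_coordinates.J_form (F \<circ> param c) (\<lambda>i. e p i \<circ> param c) b y"
proof -
  interpret fc: framed_chart \<A> F "W p" "e p" c by (rule framed_chart[OF c])
  have "y \<in> snd c ` fst c" using assms by auto
  then show ?thesis
    unfolding JdF_def fc.J_form_def
    using J_eq[OF param_in[OF c assms] dderiv_F_tangent] by simp
qed

lemma local_nbhd:
  assumes y: "y \<in> snd c ` fst c"
  shows "open (snd c ` (fst c \<inter> W (param c y)))" "y \<in> snd c ` (fst c \<inter> W (param c y))"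
  using open_chart_image_Int[OF c open_W] mem_W param_in_chart[OF c y] chart_param[OF c y] by force+

lemma smooth_JdF: "smooth_on (snd c ` fst c) (JdF c b)"
proof (rule smooth_on_local)
  fix y assume y: "y \<in> snd c ` fst c"
  let ?p = "param c y"
  interpret fc: framed_chart \<A> F "W ?p" "e ?p" c by (rule framed_chart[OF c])
  have "smooth_on (snd c ` (fst c \<inter> W ?p)) (JdF c b)"
    using smooth_on_cong[OF local_nbhd(1)[OF y], of "JdF c b" "fc.J_form b"] JdF_eq_J_form fc.smooth_J_form
    by blast
  then show "\<exists>S. open S \<and> y \<in> S \<and> smooth_on S (JdF c b)" using local_nbhd[OF y] by blast
qed

text \<open>The frame used is the one attached to the point of differentiation, where its nullspace
  condition is available.\<close>

lemma JdF_closed: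
  assumes y: "y \<in> snd c ` fst c"
  shows "dderiv (JdF c b) a y = dderiv (JdF c a) b y"
proof -
  let ?p = "param c y"
  interpret fc: framed_chart \<A> F "W ?p" "e ?p" c by (rule framed_chart[OF c])
  note nb = local_nbhd[OF y]
  have "dderiv (JdF c b) a y = dderiv (fc.J_form b) a y" for a b
    by (rule dderiv_cong_open[OF nb JdF_eq_J_form])
  then show ?thesis
    using fc.curl_eq_0_of_null[OF nb(2) null, of a b] by (simp add: fc.curl_def)
qed

lemma linear_JdF:
  assumes y: "y \<in> snd c ` fst c" shows "linear (\<lambda>b. JdF c b y)"
proof -
  note lin = dderiv_linear[OF smooth_on_differentiable[OF smooth_F_chart[OF c] y]]
  note J = J_linear[OF dderiv_F_tangent[OF y] dderiv_F_tangent[OF y]]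
  show ?thesis
  proof (rule linearI)
    show "JdF c (a + b) y = JdF c a y + JdF c b y" for a b
      using J[of 1 a 1 b] by (simp add: JdF_def linear_add[OF lin])
    show "JdF c (r *\<^sub>R b) y = r *\<^sub>R JdF c b y" for r b
      using J[of r b 0 b] by (simp add: JdF_def linear_cmul[OF lin])
  qed
qed

text \<open>Since \<open>J\<close> is skew, the Kaehler form is half the antisymmetrised pairing of the closed 1-forms
  \<open>J dF\<close> and \<open>dF\<close>.\<close>

lemma dderiv_Kaehler_form:
  assumes y: "y \<in> snd c ` fst c"
  shows "2 * dderiv (\<lambda>y. form_in_chart c F (\<lambda>p u v. \<J> p u \<bullet> v) y b d) a y
    = dderiv (JdF c b) a y \<bullet> dderiv (F \<circ> param c) d y + JdF c b y \<bullet> dderiv (dderiv (F \<circ> param c) d) a y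
      - dderiv (JdF c d) a y \<bullet> dderiv (F \<circ> param c) b y - JdF c d y \<bullet> dderiv (dderiv (F \<circ> param c) b) a y"
proof -
  let ?S = "snd c ` fst c" and ?f = "F \<circ> param c"
  note S = open_chart_image[OF c]
  have sm: "smooth_on ?S (\<lambda>y. JdF c b y \<bullet> dderiv ?f d y)" for b d
    by (intro smooth_on_inner S smooth_JdF smooth_on_dderiv smooth_F_chart c)
  have prod: "dderiv (\<lambda>z. JdF c b z \<bullet> dderiv ?f d z) a y
      = JdF c b y \<bullet> dderiv (dderiv ?f d) a y + dderiv (JdF c b) a y \<bullet> dderiv ?f d y" for b d
    by (rule dderiv_inner; rule smooth_on_differentiable[OF _ y])
      (intro smooth_JdF smooth_on_dderiv smooth_F_chart c)+
  have "form_in_chart c F (\<lambda>p u v. \<J> p u \<bullet> v) z b d = (1/2) *\<^sub>R (JdF c b z \<bullet> dderiv ?f d z - JdF c d z \<bullet> dderiv ?f b z)"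
    if z: "z \<in> ?S" for z
    using J_skew[OF dderiv_F_tangent[OF z, of b] dderiv_F_tangent[OF z, of d]]
    by (simp add: form_in_chart_def chart_derivative_def chart_param[OF c z] JdF_def)
  then have "dderiv (\<lambda>y. form_in_chart c F (\<lambda>p u v. \<J> p u \<bullet> v) y b d) a y
      = dderiv (\<lambda>z. (1/2) *\<^sub>R (JdF c b z \<bullet> dderiv ?f d z - JdF c d z \<bullet> dderiv ?f b z)) a y"
    by (rule dderiv_cong_open[OF S y])
  also have "\<dots> = (1/2) *\<^sub>R dderiv (\<lambda>z. JdF c b z \<bullet> dderiv ?f d z - JdF c d z \<bullet> dderiv ?f b z) a y"
    by (rule dderiv_eqI, rule has_derivative_scaleR_right, rule has_derivative_dderiv,
        rule smooth_on_differentiable[OF _ y], rule smooth_on_diff[OF S sm sm])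
  also have "dderiv (\<lambda>z. JdF c b z \<bullet> dderiv ?f d z - JdF c d z \<bullet> dderiv ?f b z) a y
     = dderiv (\<lambda>z. JdF c b z \<bullet> dderiv ?f d z) a y - dderiv (\<lambda>z. JdF c d z \<bullet> dderiv ?f b z) a y"
    by (rule dderiv_diff; rule smooth_on_differentiable[OF sm y])
  finally show ?thesis unfolding prod by simp
qed

end

lemma closed_Kaehler_form: "closed_two_form \<A> F (\<lambda>p u v. \<J> p u \<bullet> v)"
  unfolding closed_two_form_def
proof (intro ballI allI)
  fix c x and a b d :: "real^4" assume c: "c \<in> \<A>" and x: "x \<in> snd c ` fst c"
  note comm = dderiv_commute[OF open_chart_image[OF c] smooth_F_chart[OF c] x]
  note D = dderiv_Kaehler_form[OF c x] and cl = JdF_closed[OF c x]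
  show "dderiv (\<lambda>y. form_in_chart c F (\<lambda>p u v. \<J> p u \<bullet> v) y b d) a x
      + dderiv (\<lambda>y. form_in_chart c F (\<lambda>p u v. \<J> p u \<bullet> v) y d a) b x
      + dderiv (\<lambda>y. form_in_chart c F (\<lambda>p u v. \<J> p u \<bullet> v) y a b) d x = 0"
    using D[of b d a] D[of d a b] D[of a b d] comm[of a b] comm[of b d] comm[of d a]
      cl[of a b] cl[of b d] cl[of d a] by simp
qed

end

subsection \<open>Complex coordinates\<close>

text \<open>The coordinates of \<open>u - \<i> v\<close> along the vectors \<open>w k\<close>.\<close>

definition complex_coords :: "('i::finite \<Rightarrow> 'v::euclidean_space) \<Rightarrow> 'v \<Rightarrow> 'v \<Rightarrow> complex^'i" where
  "complex_coords w u v = (\<Sum>k\<in>UNIV. (u \<bullet> w k) *\<^sub>R axis k 1 - (v \<bullet> w k) *\<^sub>R axis k \<i>)"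

text \<open>The sum of real multiples in the definition suits the derivative and smoothness rules;
  this component form suits the algebra.\<close>

lemma complex_coords_nth: "complex_coords w u v $ k = Complex (u \<bullet> w k) (- (v \<bullet> w k))"
proof -
  have "complex_coords w u v $ k = (\<Sum>j\<in>UNIV. if j = k then Complex (u \<bullet> w k) (- (v \<bullet> w k)) else 0)"
    unfolding complex_coords_def sum_component
    by (intro sum.cong) (auto simp: axis_def complex_eq_iff)
  then show ?thesis by simp
qed

text \<open>This is \<i>(u - \<i>v) = v + \<i>u. With v = Ju it turns J into multiplication by \<i>,
  as (Ju, JJu) = (v, -u).\<close>

lemma complex_coords_rotate: "complex_coords w v (- u) = \<i> *s complex_coords w u v"
  by (simp add: vec_eq_iff complex_coords_nth complex_eq_iff)

lemma has_derivative_complex_coords: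
  assumes "(f has_derivative f') (at x)" "(g has_derivative g') (at x)"
  shows "((\<lambda>x. complex_coords w (f x) (g x)) has_derivative (\<lambda>a. complex_coords w (f' a) (g' a))) (at x)"
  unfolding complex_coords_def by (auto intro!: derivative_eq_intros assms)

lemma smooth_on_complex_coords:
  assumes "open S" "smooth_on S f" "smooth_on S g"
  shows "smooth_on S (\<lambda>x. complex_coords w (f x) (g x))"
  unfolding complex_coords_def
  by (intro smooth_on_sum smooth_on_diff smooth_on_scaleR smooth_on_inner smooth_on_const assms)

context type_A_immersion
begin

lemma complex_coordinates: "\<exists>V z. p \<in> V \<and> complex_coordinates_on \<A> F \<J> V z"
proof -
  obtain c where c: "c \<in> \<A>" "p \<in> fst c" using ex_chart .
  let ?S = "snd c ` fst c" and ?f = "F \<circ> param c"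
  define x where "x = snd c p"
  have S: "open ?S" "x \<in> ?S" using open_chart_image[OF c(1)] c(2) by (auto simp: x_def)
  obtain r where r: "r > 0" "ball x r \<subseteq> ?S" using openE[OF S] by blast
  have B: "open (ball x r)" "convex (ball x r)" "x \<in> ball x r" using r by auto
  obtain G where G: "\<And>y. y \<in> ball x r \<Longrightarrow> (G has_derivative (\<lambda>b. JdF c b y)) (at y)"
  proof (rule poincare_lemma_one_form[OF B, of "JdF c"])
    show "smooth_on (ball x r) (JdF c b)" for b
      by (rule smooth_on_subset[OF smooth_JdF[OF c(1)] r(2)])
  qed (use r(2) linear_JdF[OF c(1)] JdF_closed[OF c(1)] in auto)
  \<comment> \<open>By \<open>mult_J_mat\<close>, the products of u and Ju with e_1, e_2 at
    \<open>p\<close> are, up to sign, all four frame coordinates of u; so these two components have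
    injective differential at \<open>p\<close>.\<close>
  define w :: "2 \<Rightarrow> 'v" where "w k = (if k = 1 then e p 1 p else e p 2 p)" for k
  define z where "z q = complex_coords w (F q) (G (snd c q))" for q

  \<comment> \<open>\<open>G\<close> lives on the chart \<open>c\<close>, but smoothness is required
    in every chart, so the derivative is carried over to an arbitrary \<open>c'\<close>.\<close>
  have z_der: "(z \<circ> param c' has_derivative
      (\<lambda>a. complex_coords w (chart_derivative c' F q a) (\<J> q (chart_derivative c' F q a)))) (at (snd c' q))"
    if c': "c' \<in> \<A>" "q \<in> fst c'" and q: "q \<in> fst c" "snd c q \<in> ball x r" for c' q
  proof -
    let ?U = "snd c ` fst c \<inter> ball x r"
    have "((G \<circ> snd c) \<circ> param c has_derivative (\<lambda>b. JdF c b (snd c q))) (at (snd c q))"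
    proof (rule has_derivative_transform_within_open[OF G[OF q(2)]])
      show "open ?U" using S by auto
    qed (use q chart_param[OF c(1)] in auto)
    moreover have "JdF c b (snd c q) = \<J> q (chart_derivative c F q b)" for b
      by (simp add: JdF_def chart_derivative_def param_chart[OF c(1) q(1)])
    ultimately have "((G \<circ> snd c) \<circ> param c has_derivative (\<lambda>b. \<J> q (chart_derivative c F q b))) (at (snd c q))"
      by simp
    from chart_change[OF c(1) c'(1) q(1) c'(2) this]
    have Gd: "((G \<circ> snd c) \<circ> param c' has_derivative (\<lambda>a. \<J> q (chart_derivative c' F q a))) (at (snd c' q))"
      by (simp add: chart_derivative_change[OF c(1) c'(1) q(1) c'(2) differentiable_F[OF c(1) q(1)]])
    have Fd: "(F \<circ> param c' has_derivative chart_derivative c' F q) (at (snd c' q))"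
      unfolding chart_derivative_def by (rule has_derivative_dderiv[OF differentiable_F[OF c']])
    show ?thesis
      using has_derivative_complex_coords[OF Fd Gd, of w] by (simp add: z_def o_def)
  qed

  have zc_der: "dderiv (z \<circ> param c) a y = complex_coords w (dderiv ?f a y) (JdF c a y)"
    if y: "y \<in> ball x r" for a y
  proof -
    have yS: "y \<in> ?S" using y r by auto
    note * = z_der[OF c(1) param_in_chart[OF c(1) yS] param_in_chart[OF c(1) yS]]
    show ?thesis
      using dderiv_eqI[OF *, of a] y by (simp add: chart_param[OF c(1) yS] JdF_def chart_derivative_def)
  qed
  \<comment> \<open>\<open>G\<close> is known only to be differentiable, but the derivative of
    \<open>z\<close> is built from dF and J dF, which are smooth.\<close>
  have z_smooth: "smooth_on (snd c' ` (fst c' \<inter> V)) (z \<circ> param c')"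
    if c': "c' \<in> \<A>" and V: "open V" "\<And>q. q \<in> V \<Longrightarrow> q \<in> fst c \<and> snd c q \<in> ball x r" for c' V
  proof (rule smooth_onI_dderiv)
    let ?S' = "snd c' ` (fst c' \<inter> V)"
    have S': "open ?S'" by (rule open_chart_image_Int[OF c' V(1)])
    have z_der': "(z \<circ> param c' has_derivative
        (\<lambda>a. complex_coords w (dderiv (F \<circ> param c') a y) (JdF c' a y))) (at y)" if y: "y \<in> ?S'" for y
    proof -
      have yS: "y \<in> snd c' ` fst c'" using y by auto
      have q: "param c' y \<in> fst c \<and> snd c (param c' y) \<in> ball x r"
        using V(2) param_in[OF c' y] by blast
      show ?thesis
        using z_der[OF c' param_in_chart[OF c' yS]] q
        by (simp add: chart_param[OF c' yS] JdF_def chart_derivative_def)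
    qed
    then show "(z \<circ> param c') differentiable (at y)" if "y \<in> ?S'" for y
      using that unfolding differentiable_def by blast
    fix a
    have sm: "smooth_on ?S' (\<lambda>y. complex_coords w (dderiv (F \<circ> param c') a y) (JdF c' a y))"
      by (intro smooth_on_complex_coords S' smooth_on_dderiv smooth_on_subset[OF smooth_F_chart[OF c']]
          smooth_on_subset[OF smooth_JdF[OF c']]) auto
    show "smooth_on ?S' (dderiv (z \<circ> param c') a)"
      by (rule smooth_on_cong[OF S', THEN iffD2, OF _ sm], rule dderiv_eqI, rule z_der')
  qed

  have "inj (\<lambda>a. dderiv (z \<circ> param c) a x)"
  proof -
    have p: "param c x = p" using param_chart[OF c] by (simp add: x_def)
    have T: "dderiv ?f a x \<in> tangent_space \<A> F p" for a
      using dderiv_F_tangent[OF c(1) S(2)] p by simp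
    have lin: "linear (\<lambda>a. dderiv (z \<circ> param c) a x)"
      by (rule dderiv_linear, rule differentiableI, use z_der[OF c c(2)] B(3) in \<open>simp add: x_def\<close>)
    have "a = 0" if "dderiv (z \<circ> param c) a x = 0" for a
    proof -
      have "complex_coords w (dderiv ?f a x) (JdF c a x) $ k = 0" for k
        using that zc_der[OF B(3)] by simp
      then have 0: "dderiv ?f a x \<bullet> w k = 0" "JdF c a x \<bullet> w k = 0" for k
        by (simp_all add: complex_coords_nth complex_eq_iff)
      have "\<J> p (dderiv ?f a x) \<bullet> e p j p = (J_mat *v (\<chi> k. dderiv ?f a x \<bullet> e p k p)) $ j" for j
        by (rule J_inner_frame[OF mem_W T])
      from this[of 1] this[of 2] 0[of 1] 0[of 2]
      have "dderiv ?f a x \<bullet> e p i p = 0" for i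
        using exhaust_4[of i] by (auto simp: w_def JdF_def p)
      then have "dderiv ?f a x = 0" using tangent_expansion[OF mem_W T[of a]] by simp
      then have "chart_derivative c F p a = chart_derivative c F p 0"
        using linear_0[OF linear_chart_derivative[OF c]] by (simp add: chart_derivative_def x_def)
      then show ?thesis using injD[OF inj_chart_derivative[OF c]] by blast
    qed
    then show ?thesis using linear_injective_0[OF lin] by blast
  qed
  moreover have "smooth_on (ball x r) (z \<circ> param c)"
  proof -
    have "open (fst c \<inter> snd c -` ball x r)"
      using homeomorphism_cont1[OF chart_homeomorphism[OF c(1)]] open_chart[OF c(1)]
      by (simp add: continuous_open_preimage)
    from z_smooth[OF c(1) this] show ?thesis
      by (rule smooth_on_subset) (use r(2) in force)+
  qed
  ultimately obtain s where s: "s > 0" "ball x s \<subseteq> ball x r" "inj_on (z \<circ> param c) (ball x s)"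
    and s_inj: "\<And>y. y \<in> ball x s \<Longrightarrow> inj (\<lambda>a. dderiv (z \<circ> param c) a y)"
    using smooth_on_locally_injective[OF B(1) _ B(3)] by metis
  \<comment> \<open>On the smaller ball both \<open>z\<close> and its differentials are
    injective.\<close>
  define V where "V = fst c \<inter> snd c -` ball x s"
  have V: "q \<in> fst c \<and> snd c q \<in> ball x r" if "q \<in> V" for q using that s(2) by (auto simp: V_def)
  have open_V: "open V"
    unfolding V_def using homeomorphism_cont1[OF chart_homeomorphism[OF c(1)]] open_chart[OF c(1)]
    by (simp add: continuous_open_preimage)
  have "complex_coordinates_on \<A> F \<J> V z"
    unfolding complex_coordinates_on_def
  proof (intro conjI ballI)
    show "open V" by (rule open_V)
    show "smooth_map_on \<A> V z"
      unfolding smooth_map_on_def using z_smooth[OF _ open_V V] by force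
    show "inj_on z V"
    proof (rule inj_onI)
      fix q q' assume q: "q \<in> V" "q' \<in> V" and "z q = z q'"
      then have "(z \<circ> param c) (snd c q) = (z \<circ> param c) (snd c q')"
        using param_chart[OF c(1)] by (simp add: V_def)
      then have "snd c q = snd c q'" using inj_onD[OF s(3)] q by (simp add: V_def)
      then show "q = q'" using param_chart[OF c(1)] q by (metis IntD1 V_def)
    qed
  next
    fix q assume q: "q \<in> V"
    then have qc: "q \<in> fst c" and qr: "snd c q \<in> ball x r" and qs: "snd c q \<in> ball x s"
      using V by (auto simp: V_def)
    have pq: "param c (snd c q) = q" by (rule param_chart[OF c(1) qc])
    have diff: "(z \<circ> param c) differentiable (at (snd c q))"
      using z_der[OF c(1) qc qc qr] by (rule differentiableI)
    have dir: "dir_deriv \<A> F z q (chart_derivative c F q a) = dderiv (z \<circ> param c) a (snd c q)" for a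
      using dir_deriv_chart[OF c(1) qc diff] by (simp add: chart_derivative_def)
    have T: "tangent_space \<A> F q = range (chart_derivative c F q)"
      by (rule tangent_space_chart[OF c(1) qc])
    \<comment> \<open>The differential of \<open>z\<close> takes the components of u - \<i>Ju, so
      holomorphy comes down to JJ = -1.\<close>
    have dir_T: "dir_deriv \<A> F z q u = complex_coords w u (\<J> q u)" if u: "u \<in> tangent_space \<A> F q" for u
    proof -
      obtain a where "u = chart_derivative c F q a" using u unfolding T by blast
      then show ?thesis
        using dir[of a] zc_der[OF qr, of a] by (simp add: JdF_def chart_derivative_def pq)
    qed
    show "inj_on (dir_deriv \<A> F z q) (tangent_space \<A> F q)"
      unfolding T by (rule inj_onI) (auto simp: dir dest: injD[OF s_inj[OF qs]])
    fix v assume v: "v \<in> tangent_space \<A> F q"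
    show "dir_deriv \<A> F z q (\<J> q v) = \<i> *s dir_deriv \<A> F z q v"
      by (simp add: dir_T[OF v] dir_T[OF J_tangent[OF v]] J_J[OF v] complex_coords_rotate)
  qed
  moreover have "p \<in> V" using c(2) s(1) by (simp add: V_def x_def)
  ultimately show ?thesis by blast
qed

theorem kaehler: "kaehler \<A> F \<J>"
  using almost_complex complex_coordinates hermitian closed_Kaehler_form
  by (simp add: kaehler_def complex_structure_def)

end

theorem proposition5:
  fixes \<A> :: "('m::{t2_space, second_countable_topology}, real^4) chart set"
    and F :: "'m \<Rightarrow> 'v::euclidean_space"
    and r :: nat
    and \<J> :: "'m \<Rightarrow> 'v \<Rightarrow> 'v"
    and W :: "'m \<Rightarrow> 'm set"
    and e :: "'m \<Rightarrow> 4 \<Rightarrow> 'm \<Rightarrow> 'v"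
  assumes "DIM('v) = 4 + r"
    and "smooth_atlas \<A>"
    and "immersion \<A> F"
    and "austere \<A> F"
    and "type_A \<A> F"
    and "\<And>p. p \<in> W p"
    and "\<And>p. adapted_frame \<A> F (W p) (e p)"
    and "\<And>p. represented_by \<J> (W p) (e p) J_mat"
    and "\<And>p. common_nullspace (K_map ` Q_space \<A> F (e p) p) = {0}"
  shows "kaehler \<A> F \<J>"
proof -
  interpret type_A_immersion \<A> F \<J> W e
    by unfold_locales (fact assms)+
  show ?thesis by (rule kaehler)
qed

end
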